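(* Let $u$ be a semiconcave viscosity solution of $H(x,Du(x))=0$ in $\Omega\subset\mathbb{R}^2$, and let $x_0\in\mathrm{Sing}(u)$ be such that $0\notin H_p(x_0,D^+u(x_0))$. Let $T>0$ and let $\mathbf{x}_1,\mathbf{x}_2\in \mathrm{Lip}^u_0(0,T;\Omega)$ be such that, for $j=1,2$, $\mathbf{x}_j(0)=x_0$ and $$\dot{\mathbf{x}}_j^+(0)=H_p(x_0,p_0),\qquad\text{where } p_0=\arg\min\{H(x_0,p): p\in D^+u(x_0)\}.$$ Then there exists $\sigma\in(0,T]$ such that there exists a unique bi-Lipschitz homeomorphism $\phi:[0,\sigma]\to[0,\phi(\sigma)]\subset[0,T]$ satisfying $\mathbf{x}_1(s)=\mathbf{x}_2(\phi(s))$ for all $s\in[0,\sigma]$.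
   Context: Setting: $\Omega\subset\mathbb{R}^2$ is a bounded domain and $H:\Omega\times\mathbb{R}^2\to\mathbb{R}$, $(x,p)\mapsto H(x,p)$, is of class $C^1$ and strictly convex in $p$; $H_p$ denotes the gradient in $p$, and $H_p(x,A)=\{H_p(x,p):p\in A\}$ for a set $A$. Solutions of $H(x,Du(x))=0$ in $\Omega$ are understood in the viscosity sense. A function $u:\Omega\to\mathbb{R}$ is semiconcave (with linear modulus) if there is $C>0$ with $\lambda u(x)+(1-\lambda)u(y)-u(\lambda x+(1-\lambda)y)\le \frac C2\lambda(1-\lambda)|x-y|^2$ for all $\lambda\in[0,1]$ and all $x,y\in\Omega$ such that the segment joining $x$ and $y$ lies in $\Omega$. The superdifferential is $D^+u(x)=\{p:\limsup_{y\to x}\frac{u(y)-u(x)-\langle p,y-x\rangle}{|y-x|}\le 0\}$; for semiconcave $u$ it is a nonempty compact convex set. $\mathrm{Sing}(u)$ is the set of $x\in\Omega$ such that $D^+u(x)$ is not a singleton. $\mathrm{Lip}_0(0,T;\Omega)$ is the class of all Lipschitz arcs $\mathbf{x}:[0,T]\to\Omega$ such that the right derivative $\dot{\mathbf{x}}^+(0)=\lim_{t\downarrow0}\frac{\mathbf{x}(t)-\mathbf{x}(0)}{t}$ exists and $\lim_{t\to0^+}\operatorname{ess\,sup}_{s\in[0,t]}|\dot{\mathbf{x}}(s)-\dot{\mathbf{x}}^+(0)|=0$. $\mathrm{Lip}^u_0(0,T;\Omega)$ is the subset of those $\mathbf{x}\in\mathrm{Lip}_0(0,T;\Omega)$ with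 $\mathbf{x}(t)\in\mathrm{Sing}(u)$ for all $t\in[0,T]$. *)

theory Defs
  imports "HOL-Analysis.Analysis" "HOL-Probability.Essential_Supremum"
begin

definition C1_on :: "'a::real_normed_vector set \<Rightarrow> ('a \<Rightarrow> 'b::real_normed_vector) \<Rightarrow> bool" where
  "C1_on S f \<longleftrightarrow>
     (\<exists>f'. (\<forall>z\<in>S. (f has_derivative blinfun_apply (f' z)) (at z)) \<and> continuous_on S f')"

definition strictly_convex :: "('a::real_vector \<Rightarrow> real) \<Rightarrow> bool" where
  "strictly_convex f \<longleftrightarrow>
     (\<forall>p q t. p \<noteq> q \<and> 0 < t \<and> t < 1 \<longrightarrow>
        f (t *\<^sub>R p + (1 - t) *\<^sub>R q) < t * f p + (1 - t) * f q)"

definition H_p :: "('a \<Rightarrow> 'b::real_inner \<Rightarrow> real) \<Rightarrow> 'a \<Rightarrow> 'b \<Rightarrow> 'b" where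
  "H_p H x p = (THE g. GDERIV (H x) p :> g)"

definition semiconcave :: "'a::euclidean_space set \<Rightarrow> ('a \<Rightarrow> real) \<Rightarrow> bool" where
  "semiconcave \<Omega> u \<longleftrightarrow>
     (\<exists>C>0. \<forall>x\<in>\<Omega>. \<forall>y\<in>\<Omega>. closed_segment x y \<subseteq> \<Omega> \<longrightarrow>
        (\<forall>l\<in>{0..1}. l * u x + (1 - l) * u y - u (l *\<^sub>R x + (1 - l) *\<^sub>R y)
                      \<le> C / 2 * l * (1 - l) * (norm (x - y))\<^sup>2))"

text \<open>Functions on \<open>\<Omega>\<close> are total functions whose values outside \<open>\<Omega>\<close> are irrelevant; hence the
  limits below are taken within \<open>\<Omega>\<close>.\<close>

definition superdiff :: "'a::euclidean_space set \<Rightarrow> ('a \<Rightarrow> real) \<Rightarrow> 'a \<Rightarrow> 'a set" where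
  "superdiff \<Omega> u x =
     {p. Limsup (at x within \<Omega>)
           (\<lambda>y. ereal ((u y - u x - p \<bullet> (y - x)) / norm (y - x))) \<le> 0}"

definition subdiff :: "'a::euclidean_space set \<Rightarrow> ('a \<Rightarrow> real) \<Rightarrow> 'a \<Rightarrow> 'a set" where
  "subdiff \<Omega> u x =
     {p. Liminf (at x within \<Omega>)
           (\<lambda>y. ereal ((u y - u x - p \<bullet> (y - x)) / norm (y - x))) \<ge> 0}"

definition Sing :: "'a::euclidean_space set \<Rightarrow> ('a \<Rightarrow> real) \<Rightarrow> 'a set" where
  "Sing \<Omega> u = {x \<in> \<Omega>. \<not> is_singleton (superdiff \<Omega> u x)}"

text \<open>Viscosity solutions of \<open>H(x, Du(x)) = 0\<close> in \<open>\<Omega>\<close>, defined through the one-sided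
  differentials.\<close>

definition viscosity_subsolution ::
    "'a::euclidean_space set \<Rightarrow> ('a \<Rightarrow> 'a \<Rightarrow> real) \<Rightarrow> ('a \<Rightarrow> real) \<Rightarrow> bool" where
  "viscosity_subsolution \<Omega> H u \<longleftrightarrow>
     continuous_on \<Omega> u \<and> (\<forall>x\<in>\<Omega>. \<forall>p\<in>superdiff \<Omega> u x. H x p \<le> 0)"

definition viscosity_supersolution ::
    "'a::euclidean_space set \<Rightarrow> ('a \<Rightarrow> 'a \<Rightarrow> real) \<Rightarrow> ('a \<Rightarrow> real) \<Rightarrow> bool" where
  "viscosity_supersolution \<Omega> H u \<longleftrightarrow>
     continuous_on \<Omega> u \<and> (\<forall>x\<in>\<Omega>. \<forall>p\<in>subdiff \<Omega> u x. H x p \<ge> 0)"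

definition viscosity_solution ::
    "'a::euclidean_space set \<Rightarrow> ('a \<Rightarrow> 'a \<Rightarrow> real) \<Rightarrow> ('a \<Rightarrow> real) \<Rightarrow> bool" where
  "viscosity_solution \<Omega> H u \<longleftrightarrow>
     viscosity_subsolution \<Omega> H u \<and> viscosity_supersolution \<Omega> H u"

text \<open>An arc on \<open>[0,T]\<close> is a total function on the reals whose values outside \<open>[0,T]\<close> are
  irrelevant. A Lipschitz arc is differentiable almost everywhere on \<open>[0,T]\<close>, so the value of
  \<^const>\<open>vector_derivative\<close> at points of non-differentiability does not affect the essential
  supremum.\<close>

definition Lip0 :: "real \<Rightarrow> 'a::euclidean_space set \<Rightarrow> (real \<Rightarrow> 'a) set" where
  "Lip0 T \<Omega> =
     {X. X ` {0..T} \<subseteq> \<Omega> \<and> (\<exists>L. L-lipschitz_on {0..T} X) \<and>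
          (\<exists>v. (X has_vector_derivative v) (at_right 0) \<and>
               ((\<lambda>t. esssup (lebesgue_on {0..t})
                       (\<lambda>s. ereal (norm (vector_derivative X (at s within {0..T}) - v))))
                 \<longlongrightarrow> 0) (at_right 0))}"

definition Lip0_sing ::
    "('a::euclidean_space \<Rightarrow> real) \<Rightarrow> real \<Rightarrow> 'a set \<Rightarrow> (real \<Rightarrow> 'a) set" where
  "Lip0_sing u T \<Omega> = {X \<in> Lip0 T \<Omega>. \<forall>t\<in>{0..T}. X t \<in> Sing \<Omega> u}"

definition bilipschitz_homeomorphism ::
    "'a::metric_space set \<Rightarrow> 'b::metric_space set \<Rightarrow> ('a \<Rightarrow> 'b) \<Rightarrow> bool" where
  "bilipschitz_homeomorphism S S' f \<longleftrightarrow>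
     (\<exists>g. homeomorphism S S' f g \<and> (\<exists>L. L-lipschitz_on S f) \<and> (\<exists>L. L-lipschitz_on S' g))"

end

(*
  Let v be the common initial velocity and n a vector orthogonal to v.  Since p0 minimises the
  strictly convex H(x0,.) over the superdifferential of u at x0, H(x0,p0) < 0, so H(x0,.) is still
  negative at p0 + c n and p0 - c n for a small c > 0.

  At almost every time t an arc X and u along X are differentiable, hence all supergradients
  at X(t) have the same component along the velocity X'(t), which is close to v.  As X(t) is
  singular, they form a nondegenerate segment almost parallel to n, whose endpoints are limits of
  gradients and so carry H >= 0, while H <= 0 on the segment; by convexity H >= 0 beyond the endpoints.
  Letting t tend to 0, the segment must reach beyond both p0 + c n and p0 - c n.  By closedness of
  the superdifferential this holds for all small t > 0.

  If now X1(t) - X2(s) = h n with h > 0, choose supergradients p at X1(t) beyond p0 + c n and q at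
  X2(s) beyond p0 - c n: semiconcavity gives (p - q).(X1(t) - X2(s)) <= C |X1(t) - X2(s)|^2, which
  forces h >= 2 c / C.  Near x0 this is impossible, so points of the two arcs at the same height
  along v coincide, and phi matches the heights.
*)

theory Submission
  imports Defs
begin

section \<open>Lipschitz functions of a real variable are differentiable almost everywhere\<close>

text \<open>Velocities are controlled only almost everywhere, through an essential supremum, so
  nothing about an individual time comes for free. Two devices deal with this: a mean value
  inequality that tolerates a null set of times, and local compactness of supergradients, which
  carries a property from almost every time to every time.

  Why the moving segments can be compared with fixed points beside \<open>p0\<close>:
  \<open>v\<close> is the gradient of H(x0,.) at its minimiser \<open>p0\<close> over a convex set,
  so by the first-order condition \<open>p0\<close> has the least inner product with
  \<open>v\<close> among the supergradients at x0. Supergradients at points approaching x0 in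
  direction \<open>v\<close> accumulate on exactly that face, because semiconcavity makes them
  monotone up to a quadratic error. In the plane this face lies on the line through
  \<open>p0\<close> orthogonal to \<open>v\<close>.

  The sign of H at a chosen endpoint comes from points where \<open>u\<close> is touched from below
  by a paraboloid. These points are placed along a prescribed direction, and the direction decides
  which endpoint the limit of the gradients reaches.\<close>

lemma le_if_step_right:
  fixes F :: "real \<Rightarrow> real"
  assumes "a \<le> b" and cont: "continuous_on {a..b} F"
    and step: "\<And>x. a \<le> x \<Longrightarrow> x < b \<Longrightarrow> \<exists>y. x < y \<and> y \<le> b \<and> F x \<le> F y"
  shows "F a \<le> F b"
proof -
  \<comment> \<open>Continuous induction: \<open>S\<close> is compact, and a largest point below
    \<open>b\<close> could still be moved to the right by \<open>step\<close>.\<close>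
  define S where "S = {y \<in> {a..b}. F a \<le> F y}"
  have "closed S"
    unfolding S_def by (intro continuous_on_closed_Collect_le cont continuous_intros)
  moreover have "bounded S"
    by (rule bounded_subset[of "{a..b}"]) (auto simp: S_def)
  ultimately have "compact S"
    by (simp add: compact_eq_bounded_closed)
  moreover have "a \<in> S" using \<open>a \<le> b\<close> by (auto simp: S_def)
  ultimately obtain m where m: "m \<in> S" "\<And>y. y \<in> S \<Longrightarrow> y \<le> m"
    using compact_attains_sup[of S] by blast
  have "m = b"
  proof (rule ccontr)
    assume "m \<noteq> b"
    then obtain y where "m < y" "y \<le> b" "F m \<le> F y"
      using step[of m] m(1) by (auto simp: S_def)
    then show False using m(1) m(2)[of y] by (auto simp: S_def)
  qed
  then show ?thesis using m(1) by (auto simp: S_def)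
qed

section \<open>Increment and density estimates on the line\<close>

lemma measure_Int_interval_split:
  fixes K :: "real set"
  assumes "K \<in> sets borel" "a \<le> x" "x \<le> y"
  shows "measure lborel (K \<inter> {a..y}) = measure lborel (K \<inter> {a..x}) + measure lborel (K \<inter> {x..y})"
proof -
  have fin: "K \<inter> {c..d} \<in> fmeasurable lborel" for c d
    using fmeasurable_Int_fmeasurable[OF fmeasurable_compact[OF compact_Icc[of c d]], of K] assms(1)
    by (simp add: Int_commute)
  have eq: "K \<inter> {a..y} = (K \<inter> {a..x}) \<union> (K \<inter> {x..y})" using assms by auto
  have "measure lborel (K \<inter> {a..x} \<inter> (K \<inter> {x..y})) \<le> measure lborel {x..x}"
    using fin assms(1) by (intro measure_mono_fmeasurable fmeasurable_compact compact_Icc) auto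
  then have "measure lborel (K \<inter> {a..x} \<inter> (K \<inter> {x..y})) = 0"
    by (simp add: order_antisym)
  then show ?thesis
    unfolding eq using fin[of a x] fin[of x y] by (simp add: measure_Un3)
qed

lemma measure_Int_interval_le:
  fixes K :: "real set"
  assumes "K \<in> sets borel" "x \<le> y"
  shows "measure lborel (K \<inter> {x..y}) \<le> y - x"
proof -
  have "measure lborel (K \<inter> {x..y}) \<le> measure lborel {x..y}"
    using assms by (intro measure_mono_fmeasurable) (auto simp: fmeasurableI)
  then show ?thesis using assms by simp
qed

lemma continuous_on_measure_Int_interval:
  fixes K :: "real set"
  assumes "K \<in> sets borel"
  shows "continuous_on {a..b} (\<lambda>y. measure lborel (K \<inter> {a..y}))"
proof -
  have "1-lipschitz_on {a..b} (\<lambda>y. measure lborel (K \<inter> {a..y}))"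
  proof (rule lipschitz_on_leI)
    fix x y assume "x \<in> {a..b}" "y \<in> {a..b}" "x \<le> y"
    then show "dist (measure lborel (K \<inter> {a..x})) (measure lborel (K \<inter> {a..y})) \<le> 1 * dist x y"
      using measure_Int_interval_split[OF assms, of a x y] measure_Int_interval_le[OF assms, of x y]
      by (auto simp: dist_real_def)
  qed auto
  then show ?thesis by (rule lipschitz_on_continuous_on)
qed

lemma lipschitz_onD_real:
  fixes f :: "real \<Rightarrow> real"
  assumes "L-lipschitz_on S f" "x \<in> S" "y \<in> S" "x \<le> y"
  shows "f y - f x \<le> L * (y - x)" "- (L * (y - x)) \<le> f y - f x"
  using lipschitz_onD[OF assms(1-3)] assms(4) by (auto simp: dist_real_def)

text \<open>Slope \<open>s\<close> on \<open>K\<close> and the worst possible slope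
  \<open>- L\<close> off \<open>K\<close> add up to this bound. The auxiliary \<open>F\<close> does
  not fall along suitable steps: at a point of \<open>K\<close> the assumed steep step is used,
  elsewhere a short interval missing \<open>K\<close>. Chaining such steps takes the place of a
  covering argument.\<close>

lemma increment_ge_if_upper_slopes:
  fixes f :: "real \<Rightarrow> real"
  assumes lip: "L-lipschitz_on UNIV f" and K: "closed K" and "a \<le> b"
    and slope: "\<And>x d. x \<in> K \<Longrightarrow> d > 0 \<Longrightarrow> \<exists>y. x < y \<and> y < x + d \<and> f y - f x \<ge> s * (y - x)"
    and "s \<ge> - L"
  shows "(s + L) * measure lborel (K \<inter> {a..b}) - L * (b - a) \<le> f b - f a"
proof -
  have KB: "K \<in> sets borel" using K by simp
  define F where "F y = f y - (s + L) * measure lborel (K \<inter> {a..y}) + L * y" for y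
  have inc: "F y - F x = f y - f x - (s + L) * measure lborel (K \<inter> {x..y}) + L * (y - x)"
    if "a \<le> x" "x \<le> y" for x y
    unfolding F_def using measure_Int_interval_split[OF KB that] by (simp add: algebra_simps)
  have "F a \<le> F b"
  proof (rule le_if_step_right[OF \<open>a \<le> b\<close>])
    show "continuous_on {a..b} F"
      unfolding F_def
      by (intro continuous_intros continuous_on_measure_Int_interval[OF KB]
          continuous_on_subset[OF lipschitz_on_continuous_on[OF lip]]) auto
  next
    fix x assume x: "a \<le> x" "x < b"
    show "\<exists>y. x < y \<and> y \<le> b \<and> F x \<le> F y"
    proof (cases "x \<in> K")
      case True
      then obtain y where y: "x < y" "y < b" "f y - f x \<ge> s * (y - x)"
        using slope[of x "b - x"] x by auto
      have "(s + L) * measure lborel (K \<inter> {x..y}) \<le> (s + L) * (y - x)"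
        using measure_Int_interval_le[OF KB, of x y] y \<open>s \<ge> - L\<close> by (intro mult_left_mono) auto
      then have "F x \<le> F y" using inc[of x y] x y by (simp add: algebra_simps)
      then show ?thesis using y by auto
    next
      case False
      then obtain d where d: "d > 0" "ball x d \<subseteq> - K"
        using K open_contains_ball[of "- K"] by (auto simp: open_Compl)
      define y where "y = min b (x + d / 2)"
      have y: "x < y" "y \<le> b" "y \<le> x + d / 2" using d x by (auto simp: y_def)
      have "K \<inter> {x..y} = {}"
        using d y by (auto simp: subset_iff dist_real_def)
      moreover have "f y - f x \<ge> - (L * (y - x))"
        using lipschitz_onD_real[OF lip, of x y] y by auto
      ultimately have "F x \<le> F y" using inc[of x y] x y by simp
      then show ?thesis using y by auto
    qed
  qed
  then show ?thesis using inc[of a b] \<open>a \<le> b\<close> by simp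
qed

text \<open>Take an open \<open>U\<close> around \<open>K\<close> with small excess. Steps starting
  in \<open>U\<close> stay in \<open>U\<close> and use the density bound; steps starting outside
  \<open>U\<close> miss \<open>K\<close>. Hence |K| <= \<theta> |U|, while |U| exceeds |K| by at
  most \<open>e\<close>.\<close>

lemma measure_eq_0_if_interval_density_less_1:
  fixes K :: "real set"
  assumes K: "compact K" and \<theta>: "0 \<le> \<theta>" "\<theta> < 1"
    and dens: "\<And>a b. a \<le> b \<Longrightarrow> measure lborel (K \<inter> {a..b}) \<le> \<theta> * (b - a)"
  shows "measure lborel K = 0"
proof -
  have KB: "K \<in> sets borel" using K by (simp add: compact_imp_closed)
  have *: "measure lborel K \<le> \<theta> * measure lborel K + e" if "e > 0" for e
  proof -
    obtain U where U: "open U" "K \<subseteq> U" "emeasure lborel (U - K) < ennreal e"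
      using outer_regular_lborel[OF KB, of e] \<open>e > 0\<close> by auto
    have UB: "U \<in> sets borel" using U by simp
    have Kf: "K \<in> fmeasurable lborel" using K by (rule fmeasurable_compact)
    have UKf: "U - K \<in> fmeasurable lborel" using U
      by (intro fmeasurableI) (auto simp: KB intro: less_trans)
    have mUK: "measure lborel (U - K) \<le> e"
      using U(3) \<open>e > 0\<close> unfolding emeasure_eq_measure2[OF UKf]
      by (simp add: ennreal_less_iff)
    obtain r where r: "\<And>x. x \<in> K \<Longrightarrow> \<bar>x\<bar> \<le> r" "r \<ge> 0"
      using compact_imp_bounded[OF K] unfolding bounded_pos by (metis less_imp_le real_norm_def)
    define F where "F y = \<theta> * measure lborel (U \<inter> {-r..y}) - measure lborel (K \<inter> {-r..y})" for y
    have inc: "F y - F x = \<theta> * measure lborel (U \<inter> {x..y}) - measure lborel (K \<inter> {x..y})"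
      if "-r \<le> x" "x \<le> y" for x y
      unfolding F_def using measure_Int_interval_split[OF KB that] measure_Int_interval_split[OF UB that]
      by (simp add: algebra_simps)
    have "F (-r) \<le> F r"
    proof (rule le_if_step_right[where F = F])
      show "continuous_on {-r..r} F"
        unfolding F_def
        by (intro continuous_intros continuous_on_measure_Int_interval KB UB)
    next
      fix x assume x: "- r \<le> x" "x < r"
      define V where "V = (if x \<in> U then U else - K)"
      have "open V" "x \<in> V" using U K by (auto simp: V_def compact_imp_closed)
      then obtain d where d: "d > 0" "ball x d \<subseteq> V" by (meson openE)
      define y where "y = min r (x + d / 2)"
      have y: "x < y" "y \<le> r" "y \<le> x + d / 2" using d x by (auto simp: y_def)
      have sub: "{x..y} \<subseteq> V" using d y by (auto simp: subset_iff dist_real_def)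
      have "F x \<le> F y"
      proof (cases "x \<in> U")
        case True
        then have "U \<inter> {x..y} = {x..y}" using sub by (auto simp: V_def)
        then show ?thesis using inc[of x y] x y dens[of x y] by simp
      next
        case False
        then have "K \<inter> {x..y} = {}" using sub by (auto simp: V_def)
        moreover have "0 \<le> \<theta> * measure lborel (U \<inter> {x..y})" using \<theta> by simp
        ultimately show ?thesis using inc[of x y] x y by simp
      qed
      then show "\<exists>y. x < y \<and> y \<le> r \<and> F x \<le> F y" using y by auto
    qed (use r in auto)
    then have "measure lborel (K \<inter> {-r..r}) \<le> \<theta> * measure lborel (U \<inter> {-r..r})"
      using inc[of "-r" r] r by simp
    moreover have "K \<inter> {-r..r} = K" using r by (force simp: abs_le_iff)
    moreover have "measure lborel (U \<inter> {-r..r}) \<le> measure lborel K + measure lborel (U - K)"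
    proof -
      have "measure lborel (U \<inter> {-r..r}) \<le> measure lborel (K \<union> (U - K))"
        using fmeasurable.Un[OF Kf UKf] UB by (intro measure_mono_fmeasurable) auto
      also have "\<dots> \<le> measure lborel K + measure lborel (U - K)"
        using Kf UKf by (intro measure_Un_le) auto
      finally show ?thesis .
    qed
    ultimately have "measure lborel K \<le> \<theta> * (measure lborel K + e)"
      using mUK \<theta> by (smt (verit) mult_left_mono)
    also have "\<dots> \<le> \<theta> * measure lborel K + e" using \<theta> \<open>e > 0\<close>
      by (simp add: algebra_simps mult_left_le)
    finally show ?thesis .
  qed
  have "measure lborel K \<le> \<theta> * measure lborel K"
    by (rule field_le_epsilon) (use * in auto)
  moreover have "measure lborel K \<ge> 0" by simp
  ultimately show ?thesis using \<theta> by (smt (verit) mult_le_cancel_right1)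
qed

text \<open>Lies between the sets where the upper right Dini derivative is > \<open>s\<close> and >=
  \<open>s\<close>. The form without quotients delivers the steps that the increment estimates chain
  together.\<close>

definition upper_slope_right :: "(real \<Rightarrow> real) \<Rightarrow> real \<Rightarrow> real set" where
  "upper_slope_right f s = {x. \<forall>d>0. \<exists>y. x < y \<and> y < x + d \<and> f y - f x > s * (y - x)}"

definition upper_slope_left :: "(real \<Rightarrow> real) \<Rightarrow> real \<Rightarrow> real set" where
  "upper_slope_left f s = {x. \<forall>d>0. \<exists>y. y < x \<and> x - d < y \<and> f x - f y > s * (x - y)}"

lemma upper_slope_left_eq_reflect:
  "upper_slope_left f s = uminus -` upper_slope_right (\<lambda>x. - f (- x)) s"
proof -
  have "(\<exists>y. y < x \<and> x - d < y \<and> f x - f y > s * (x - y)) \<longleftrightarrow>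
        (\<exists>y. - x < y \<and> y < - x + d \<and> - f (- y) - - f x > s * (y - - x))" (is "?l \<longleftrightarrow> ?r") for x d
  proof
    assume ?l
    then obtain y where "y < x" "x - d < y" "f x - f y > s * (x - y)" by blast
    then show ?r by (intro exI[of _ "- y"]) (auto simp: algebra_simps)
  next
    assume ?r
    then obtain y where "- x < y" "y < - x + d" "- f (- y) - - f x > s * (y - - x)" by blast
    then show ?l by (intro exI[of _ "- y"]) (auto simp: algebra_simps)
  qed
  then show ?thesis
    by (auto simp: upper_slope_left_def upper_slope_right_def)
qed

text \<open>A G-delta set: for a fixed increment \<open>q\<close> the condition is open by
  continuity, so even the uncountable union over small \<open>q\<close> is open.\<close>

lemma borel_upper_slope_right:
  assumes "continuous_on UNIV f"
  shows "upper_slope_right f s \<in> sets borel"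
proof -
  define G where "G n = (\<Union>q\<in>{0<..<1 / real (Suc n)}. {x. f (x + q) - f x > s * q})" for n
  have "open (G n)" for n
  proof -
    have "open {x. s * q < f (x + q) - f x}" for q
      by (intro open_Collect_less continuous_intros continuous_on_compose2[OF assms]) auto
    then show ?thesis unfolding G_def by auto
  qed
  moreover have "upper_slope_right f s = (\<Inter>n. G n)"
  proof safe
    fix x n assume "x \<in> upper_slope_right f s"
    then obtain y where "x < y" "y < x + 1 / real (Suc n)" "f y - f x > s * (y - x)"
      unfolding upper_slope_right_def by (smt (verit) mem_Collect_eq of_nat_0_less_iff zero_less_Suc zero_less_divide_1_iff)
    then show "x \<in> G n"
      unfolding G_def by (intro UN_I[of "y - x"]) auto
  next
    fix x assume *: "x \<in> (\<Inter>n. G n)"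
    show "x \<in> upper_slope_right f s"
      unfolding upper_slope_right_def
    proof (intro CollectI allI impI)
      fix d :: real assume "d > 0"
      then obtain n where n: "1 / real (Suc n) < d" using nat_approx_posE by blast
      have "x \<in> G n" using * by blast
      then obtain q where "0 < q" "q < 1 / real (Suc n)" "f (x + q) - f x > s * q"
        unfolding G_def by auto
      then show "\<exists>y. x < y \<and> y < x + d \<and> f y - f x > s * (y - x)"
        using n by (intro exI[of _ "x + q"]) auto
    qed
  qed
  ultimately show ?thesis by simp
qed

lemma borel_upper_slope_left:
  assumes "continuous_on UNIV f"
  shows "upper_slope_left f s \<in> sets borel"
proof -
  have "continuous_on UNIV (\<lambda>x. - f (- x))"
    by (intro continuous_intros continuous_on_compose2[OF assms]) auto
  from borel_upper_slope_right[OF this, of s]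
  have "uminus -` upper_slope_right (\<lambda>x. - f (- x)) s \<in> sets borel"
    using measurable_sets[OF borel_measurable_uminus[OF measurable_ident]] by (simp add: space_borel)
  then show ?thesis unfolding upper_slope_left_eq_reflect .
qed

lemma measure_reflect_Int_interval:
  fixes K :: "real set"
  assumes "K \<in> sets borel"
  shows "measure lborel (uminus -` K \<inter> {- b..- a}) = measure lborel (K \<inter> {a..b})"
proof -
  have "measure lborel (K \<inter> {a..b}) = measure (distr lborel borel uminus) (K \<inter> {a..b})"
    by (simp add: lborel_distr_uminus)
  also have "\<dots> = measure lborel (uminus -` (K \<inter> {a..b}))"
    using assms by (subst measure_distr) auto
  also have "uminus -` (K \<inter> {a..b}) = uminus -` K \<inter> {- b..- a}"
    by auto
  finally show ?thesis by simp
qed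

lemma increment_ge_on_upper_slope:
  fixes f :: "real \<Rightarrow> real"
  assumes lip: "L-lipschitz_on UNIV f" and K: "closed K" and "a \<le> b" and "s \<ge> - L"
    and sub: "K \<subseteq> upper_slope_right f s \<or> K \<subseteq> upper_slope_left f s"
  shows "(s + L) * measure lborel (K \<inter> {a..b}) - L * (b - a) \<le> f b - f a"
  using sub
proof
  assume "K \<subseteq> upper_slope_right f s"
  then show ?thesis
    by (intro increment_ge_if_upper_slopes assms)
       (force simp: upper_slope_right_def intro: less_imp_le)
next
  assume sub: "K \<subseteq> upper_slope_left f s"
  \<comment> \<open>The reflection turns left slopes into right slopes and keeps increments:
    \<open>?g (- a) - ?g (- b) = f b - f a\<close>.\<close>
  let ?g = "\<lambda>x. - f (- x)"
  have lipg: "L-lipschitz_on UNIV ?g"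
  proof (rule lipschitz_onI)
    fix x y :: real
    have "dist (f (- x)) (f (- y)) \<le> L * dist (- x) (- y)" by (intro lipschitz_onD[OF lip]) auto
    then show "dist (?g x) (?g y) \<le> L * dist x y" by (simp only: dist_minus)
  qed (rule lipschitz_on_nonneg[OF lip])
  have "closed (uminus -` K)"
    using K by (intro closed_vimage continuous_intros) 
  moreover have "uminus -` K \<subseteq> upper_slope_right ?g s"
    using sub unfolding upper_slope_left_eq_reflect by auto
  ultimately have "(s + L) * measure lborel (uminus -` K \<inter> {- b..- a}) - L * (- a - - b) \<le> ?g (- a) - ?g (- b)"
    using \<open>a \<le> b\<close> \<open>s \<ge> - L\<close> lipg
    by (intro increment_ge_if_upper_slopes)
       (force simp: upper_slope_right_def intro: less_imp_le)+
  then show ?thesis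
    using K by (simp add: measure_reflect_Int_interval)
qed

text \<open>On a set where slopes above \<open>s\<close> and below \<open>r\<close> both occur at arbitrarily small scales, the
  two bounds on \<open>f b - f a\<close> force a density less than 1 in every interval.\<close>

lemma negligible_upper_and_lower_slopes:
  fixes f :: "real \<Rightarrow> real"
  assumes lip: "L-lipschitz_on UNIV f" and rs: "- L \<le> s" "r \<le> L" "r < s"
    and A: "A \<in> {upper_slope_right f s, upper_slope_left f s}"
    and B: "B \<in> {upper_slope_right (\<lambda>x. - f x) (- r), upper_slope_left (\<lambda>x. - f x) (- r)}"
  shows "negligible (A \<inter> B)"
proof -
  have cont: "continuous_on UNIV f" using lip by (rule lipschitz_on_continuous_on)
  then have cont': "continuous_on UNIV (\<lambda>x. - f x)" by (intro continuous_intros)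
  have lip': "L-lipschitz_on UNIV (\<lambda>x. - f x)" using lip by simp
  have L: "L \<ge> 0" using lip by (rule lipschitz_on_nonneg)
  have meas: "measure lborel K = 0" if K: "compact K" "K \<subseteq> A \<inter> B" for K
  proof (rule measure_eq_0_if_interval_density_less_1[OF K(1)])
    \<comment> \<open>Adding the bounds for \<open>f\<close> and \<open>- f\<close> cancels the
      increment of \<open>f\<close> and leaves this ratio as density bound; it is below 1 because
      \<open>r < s\<close>.\<close>
    let ?\<theta> = "2 * L / (s - r + 2 * L)"
    show "0 \<le> ?\<theta>" "?\<theta> < 1" using L rs by (auto simp: divide_simps)
    fix a b :: real assume "a \<le> b"
    have "(s + L) * measure lborel (K \<inter> {a..b}) - L * (b - a) \<le> f b - f a"
      using K A rs \<open>a \<le> b\<close> by (intro increment_ge_on_upper_slope[OF lip]) (auto simp: compact_imp_closed)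
    moreover have "(- r + L) * measure lborel (K \<inter> {a..b}) - L * (b - a) \<le> - f b - - f a"
      using K B rs \<open>a \<le> b\<close> by (intro increment_ge_on_upper_slope[OF lip']) (auto simp: compact_imp_closed)
    ultimately have "(s - r + 2 * L) * measure lborel (K \<inter> {a..b}) \<le> 2 * L * (b - a)"
      by (simp add: algebra_simps)
    moreover have "s - r + 2 * L > 0" using L rs by simp
    ultimately show "measure lborel (K \<inter> {a..b}) \<le> ?\<theta> * (b - a)"
      by (simp add: pos_le_divide_eq mult.commute)
  qed
  have "A \<inter> B \<in> sets lebesgue"
    using A B borel_upper_slope_right[OF cont] borel_upper_slope_left[OF cont]
      borel_upper_slope_right[OF cont'] borel_upper_slope_left[OF cont'] by auto
  \<comment> \<open>The density argument is for compact sets, so the set is exhausted by countably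
    many of them up to a null set.\<close>
  then obtain C t where C: "fsigma C" "negligible t" "C \<union> t = A \<inter> B" 
    using lebesgue_set_almost_fsigma[of "A \<inter> B"] by (metis negligible_iff_null_sets)
  obtain F :: "nat \<Rightarrow> real set" where "range F \<subseteq> Collect compact" and F2: "C = (\<Union>n. F n)"
    using fsigma_Union_compact[THEN iffD1, OF C(1)] by (elim exE conjE)
  then have F: "\<And>n. compact (F n)" "C = (\<Union>n. F n)" by auto
  have "negligible (F n)" for n
  proof -
    have "F n \<subseteq> A \<inter> B" using F C by auto
    then have "measure lborel (F n) = 0" using meas F(1) by blast
    then show ?thesis
      using F(1)[of n] by (simp add: negligible_iff_measure0 lmeasurable_compact compact_imp_closed)
  qed
  then have "negligible C" unfolding F(2) by (intro negligible_Union_nat) auto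
  then show ?thesis using C by (metis negligible_Un)
qed

lemma mem_upper_slope_if_frequently:
  fixes f :: "real \<Rightarrow> real"
  assumes "\<exists>\<^sub>F y in at x. (f y - f x) / (y - x) > s"
  shows "x \<in> upper_slope_right f s \<union> upper_slope_left f s"
proof -
  have "(\<exists>\<^sub>F y in at_right x. (f y - f x) / (y - x) > s) \<or> (\<exists>\<^sub>F y in at_left x. (f y - f x) / (y - x) > s)"
    using assms by (auto simp: frequently_def eventually_at_split)
  then show ?thesis
  proof
    assume *: "\<exists>\<^sub>F y in at_right x. (f y - f x) / (y - x) > s"
    have "\<exists>y. x < y \<and> y < x + d \<and> f y - f x > s * (y - x)" if d: "d > 0" for d
    proof -
      obtain y where "y \<in> {x<..}" "dist y x < d" "(f y - f x) / (y - x) > s"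
        using * d unfolding frequently_at by blast
      then show ?thesis by (intro exI[of _ y]) (auto simp: dist_real_def pos_less_divide_eq)
    qed
    then show ?thesis by (auto simp: upper_slope_right_def)
  next
    assume *: "\<exists>\<^sub>F y in at_left x. (f y - f x) / (y - x) > s"
    have "\<exists>y. y < x \<and> x - d < y \<and> f x - f y > s * (x - y)" if d: "d > 0" for d
    proof -
      obtain y where "y \<in> {..<x}" "dist y x < d" "(f y - f x) / (y - x) > s"
        using * d unfolding frequently_at by blast
      moreover have "(f y - f x) / (y - x) = (f x - f y) / (x - y)"
        by (metis minus_diff_eq minus_divide_divide)
      ultimately show ?thesis by (intro exI[of _ y]) (auto simp: dist_real_def pos_less_divide_eq)
    qed
    then show ?thesis by (auto simp: upper_slope_left_def)
  qed
qed

text \<open>The Lipschitz bound keeps the lower and upper limits of the difference quotient finite,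
  so the derivative would exist if they agreed. Rational \<open>r\<close> and \<open>s\<close> are
  wanted because the exceptional set is to be covered by countably many null sets.\<close>

lemma oscillating_slope_if_not_differentiable:
  fixes f :: "real \<Rightarrow> real"
  assumes lip: "L-lipschitz_on UNIV f" and nd: "\<not> f differentiable (at x)"
  obtains r s where "r \<in> \<rat>" "s \<in> \<rat>" "- L \<le> r" "s \<le> L" "r < s"
    "\<exists>\<^sub>F y in at x. (f y - f x) / (y - x) > s" "\<exists>\<^sub>F y in at x. (f y - f x) / (y - x) < r"
proof -
  define q where "q y = ereal ((f y - f x) / (y - x))" for y
  have bd: "- L \<le> (f y - f x) / (y - x) \<and> (f y - f x) / (y - x) \<le> L" if "y \<noteq> x" for y
  proof -
    have "\<bar>(f y - f x) / (y - x)\<bar> \<le> L"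
      using lipschitz_onD[OF lip, of y x] that by (simp add: dist_real_def divide_le_eq)
    then show ?thesis unfolding abs_le_iff by linarith
  qed
  have ev: "\<forall>\<^sub>F y in at x. - L \<le> (f y - f x) / (y - x) \<and> (f y - f x) / (y - x) \<le> L"
    unfolding eventually_at by (intro exI[of _ 1]) (use bd in auto)
  have up: "Limsup (at x) q \<le> ereal L"
    by (rule Limsup_bounded) (use ev in \<open>auto simp: q_def elim!: eventually_mono\<close>)
  have lo: "ereal (- L) \<le> Liminf (at x) q"
    by (rule Liminf_bounded) (use ev in \<open>auto simp: q_def elim!: eventually_mono\<close>)
  have le: "Liminf (at x) q \<le> Limsup (at x) q"
    by (rule Liminf_le_Limsup) simp
  have "Liminf (at x) q \<noteq> Limsup (at x) q"
  proof
    assume eq: "Liminf (at x) q = Limsup (at x) q"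
    obtain l where l: "Limsup (at x) q = ereal l"
      using up lo le by (cases "Limsup (at x) q") auto
    have "(q \<longlongrightarrow> ereal l) (at x)"
      using eq l tendsto_iff_Liminf_eq_Limsup[of "at x" q "ereal l"] by simp
    then have "((\<lambda>y. (f y - f x) / (y - x)) \<longlongrightarrow> l) (at x)"
      unfolding q_def by simp
    then have "(f has_field_derivative l) (at x)"
      by (simp add: has_field_derivative_iff)
    then show False using nd by (auto simp: real_differentiable_def)
  qed
  with le have lt: "Liminf (at x) q < Limsup (at x) q" by simp
  \<comment> \<open>\<open>z\<close> separates the two limits; \<open>w\<close> and
    \<open>z'\<close> leave open gaps on either side of it for the rationals \<open>r\<close> and
    \<open>s\<close>.\<close>
  obtain z where z: "Liminf (at x) q < ereal z" "ereal z < Limsup (at x) q"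
    using ereal_dense2[OF lt] by auto
  obtain w where w: "Liminf (at x) q < ereal w" "ereal w < ereal z"
    using ereal_dense2[OF z(1)] by auto
  obtain z' where z': "ereal z < ereal z'" "ereal z' < Limsup (at x) q"
    using ereal_dense2[OF z(2)] by auto
  obtain r where r: "r \<in> \<rat>" "w < r" "r < z" using Rats_dense_in_real[of w z] w by auto
  obtain s where s: "s \<in> \<rat>" "z < s" "s < z'" using Rats_dense_in_real[of z z'] z' by auto
  have sl: "ereal s < Limsup (at x) q" using s z'(2) less_trans[of "ereal s" "ereal z'"] by simp
  have rl: "Liminf (at x) q < ereal r" using r w(1) less_trans[of _ "ereal w" "ereal r"] by simp
  show ?thesis
  proof (rule that)
    show "- L \<le> r" "s \<le> L"
      using order.strict_trans1[OF lo rl] order.strict_trans2[OF sl up] by auto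
    show "\<exists>\<^sub>F y in at x. (f y - f x) / (y - x) > s"
    proof (rule ccontr)
      assume "\<not> ?thesis"
      then have "\<forall>\<^sub>F y in at x. q y \<le> ereal s" by (simp add: q_def frequently_def not_less)
      then have "Limsup (at x) q \<le> ereal s" by (rule Limsup_bounded)
      with sl show False by simp
    qed
    show "\<exists>\<^sub>F y in at x. (f y - f x) / (y - x) < r"
    proof (rule ccontr)
      assume "\<not> ?thesis"
      then have "\<forall>\<^sub>F y in at x. ereal r \<le> q y" by (simp add: q_def frequently_def not_less)
      then have "ereal r \<le> Liminf (at x) q" by (rule Liminf_bounded)
      with rl show False by simp
    qed
  qed (use r s in auto)
qed

text \<open>Rademacher's theorem on the line. Each rational pair contributes one null set; slopes of
  \<open>f\<close> below \<open>r\<close> are read as slopes of \<open>- f\<close> above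
  \<open>- r\<close>.\<close>

theorem lipschitz_differentiable_ae_UNIV:
  fixes f :: "real \<Rightarrow> real"
  assumes lip: "L-lipschitz_on UNIV f"
  shows "negligible {x. \<not> f differentiable (at x)}"
proof -
  define I where "I = {(r, s). r \<in> \<rat> \<and> s \<in> \<rat> \<and> - L \<le> r \<and> s \<le> L \<and> r < (s::real)}"
  define U where "U g s = upper_slope_right g s \<union> upper_slope_left g s" for g s
  have "countable I"
    by (rule countable_subset[of _ "\<rat> \<times> \<rat>"]) (auto simp: I_def countable_rat)
  have null: "negligible (U f s \<inter> U (\<lambda>x. - f x) (- r))" if "(r, s) \<in> I" for r s
  proof -
    have *: "negligible (A \<inter> B)"
      if "A \<in> {upper_slope_right f s, upper_slope_left f s}"
         "B \<in> {upper_slope_right (\<lambda>x. - f x) (- r), upper_slope_left (\<lambda>x. - f x) (- r)}" for A B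
      using \<open>(r, s) \<in> I\<close> that
      by (intro negligible_upper_and_lower_slopes[OF lip, of s r]) (auto simp: I_def)
    show ?thesis
      unfolding U_def Int_Un_distrib Int_Un_distrib2 by (intro negligible_Un *) auto
  qed
  have "{x. \<not> f differentiable (at x)} \<subseteq> (\<Union>(r, s)\<in>I. U f s \<inter> U (\<lambda>x. - f x) (- r))"
  proof
    fix x assume "x \<in> {x. \<not> f differentiable (at x)}"
    then have "\<not> f differentiable (at x)" by simp
    then obtain r s where "r \<in> \<rat>" "s \<in> \<rat>" "- L \<le> r" "s \<le> L" "r < s" and
      fr: "\<exists>\<^sub>F y in at x. (f y - f x) / (y - x) > s" "\<exists>\<^sub>F y in at x. (f y - f x) / (y - x) < r"
      by (rule oscillating_slope_if_not_differentiable[OF lip])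
    then have I: "(r, s) \<in> I" by (simp add: I_def)
    have "\<exists>\<^sub>F y in at x. (- f y - - f x) / (y - x) > - r"
      using fr(2)
    proof (rule frequently_elim1)
      fix y assume "(f y - f x) / (y - x) < r"
      moreover have "(- f y - - f x) / (y - x) = - ((f y - f x) / (y - x))"
        by (simp add: minus_divide_left)
      ultimately show "(- f y - - f x) / (y - x) > - r" by linarith
    qed
    then show "x \<in> (\<Union>(r, s)\<in>I. U f s \<inter> U (\<lambda>x. - f x) (- r))"
      using mem_upper_slope_if_frequently[OF fr(1)] mem_upper_slope_if_frequently[of "- r" "\<lambda>x. - f x" x] I
      unfolding U_def by (intro UN_I[OF I]) auto
  qed
  moreover have "negligible (\<Union>(r, s)\<in>I. U f s \<inter> U (\<lambda>x. - f x) (- r))"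
    by (rule negligible_countable_Union) (use \<open>countable I\<close> null in auto)
  ultimately show ?thesis using negligible_subset by blast
qed

theorem lipschitz_differentiable_ae:
  fixes f :: "real \<Rightarrow> real"
  assumes lip: "L-lipschitz_on {a..b} f"
  shows "negligible {x \<in> {a..b}. \<not> f differentiable (at x within {a..b})}"
proof (cases "a \<le> b")
  case True
  define g where "g x = f (max a (min b x))" for x
  have "L-lipschitz_on UNIV g"
  proof (rule lipschitz_onI)
    fix x y :: real
    have "dist (g x) (g y) \<le> L * dist (max a (min b x)) (max a (min b y))"
      unfolding g_def using True by (intro lipschitz_onD[OF lip]) auto
    also have "\<dots> \<le> L * dist x y"
      by (intro mult_left_mono lipschitz_on_nonneg[OF lip]) (auto simp: dist_real_def)
    finally show "dist (g x) (g y) \<le> L * dist x y" .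
  qed (rule lipschitz_on_nonneg[OF lip])
  then have "negligible {x. \<not> g differentiable (at x)}" by (rule lipschitz_differentiable_ae_UNIV)
  moreover have "f differentiable (at x within {a..b})" if "x \<in> {a..b}" "g differentiable (at x)" for x
  proof -
    have "g differentiable (at x within {a..b})" using that(2) by (rule differentiable_at_withinI)
    then show ?thesis
      by (rule differentiable_transform_within[OF _ zero_less_one that(1)]) (auto simp: g_def)
  qed
  ultimately show ?thesis
    by (elim negligible_subset) auto
qed simp

text \<open>An open \<open>U\<close> of small measure around \<open>N\<close> is charged at rate
  \<open>M\<close>, which pays for any step inside \<open>U\<close>. Outside \<open>U\<close> the
  derivative provides a step of slope below \<open>c + e\<close>.\<close>

lemma increment_le_if_derivative_le_ae:
  fixes f :: "real \<Rightarrow> real"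
  assumes lip: "L-lipschitz_on {a..b} f" and "a \<le> b" and N: "negligible N"
    and der: "\<And>x. a < x \<Longrightarrow> x < b \<Longrightarrow> x \<notin> N \<Longrightarrow> \<exists>D\<le>c. (f has_real_derivative D) (at x)"
  shows "f b - f a \<le> c * (b - a)"
proof (rule field_le_epsilon)
  fix e0 :: real assume "e0 > 0"
  \<comment> \<open>\<open>L + \<bar>c\<bar>\<close> covers the worst step inside \<open>U\<close>,
    \<open>b - a\<close> absorbs the error \<open>e * (b - a)\<close>, and 1 makes \<open>M\<close>
    positive. With \<open>e = e0 / (2 * M)\<close> the two errors together are at most
    \<open>e0\<close>.\<close>
  define M where "M = L + \<bar>c\<bar> + (b - a) + 1"
  have L: "L \<ge> 0" using lip by (rule lipschitz_on_nonneg)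
  then have M: "M > 0" "M \<ge> L + \<bar>c\<bar>" "M \<ge> b - a" using \<open>a \<le> b\<close> by (auto simp: M_def)
  define e where "e = e0 / (2 * M)"
  have e: "e > 0" "M * e \<le> e0 / 2" using \<open>e0 > 0\<close> M by (auto simp: e_def)
  \<comment> \<open>The left endpoint joins the exceptional set because \<open>der\<close> speaks of
    interior points, whereas a step must also start at \<open>a\<close>.\<close>
  have N': "insert a N \<in> null_sets lebesgue"
    using N by (simp add: negligible_iff_null_sets[symmetric] negligible_insert)
  obtain U where U: "open U" "insert a N \<subseteq> U" "U - insert a N \<in> lmeasurable"
      "emeasure lebesgue (U - insert a N) < ennreal e"
    using sets_lebesgue_outer_open[OF null_setsD2[OF N'] \<open>e > 0\<close>] by blast
  have UB: "U \<in> sets borel" using U by simp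
  have "emeasure lebesgue U = emeasure lebesgue (U - insert a N)"
    using emeasure_Diff_null_set[OF N'] UB by simp
  then have mU: "emeasure lborel U < ennreal e" using U UB by simp
  then have Uf: "U \<in> fmeasurable lborel" using UB by (intro fmeasurableI) (auto intro: less_trans)
  have mU': "measure lborel U \<le> e"
    using mU \<open>e > 0\<close> unfolding emeasure_eq_measure2[OF Uf] by (simp add: ennreal_less_iff)
  define F where "F y = (c + e) * y + M * measure lborel (U \<inter> {a..y}) - f y" for y
  have inc: "F y - F x = (c + e) * (y - x) + M * measure lborel (U \<inter> {x..y}) - (f y - f x)"
    if "a \<le> x" "x \<le> y" for x y
    unfolding F_def using measure_Int_interval_split[OF UB that] by (simp add: algebra_simps)
  have "F a \<le> F b"
  proof (rule le_if_step_right[OF \<open>a \<le> b\<close>])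
    show "continuous_on {a..b} F"
      unfolding F_def
      by (intro continuous_intros continuous_on_measure_Int_interval[OF UB]
          lipschitz_on_continuous_on[OF lip])
  next
    fix x assume x: "a \<le> x" "x < b"
    show "\<exists>y. x < y \<and> y \<le> b \<and> F x \<le> F y"
    proof (cases "x \<in> U")
      case True
      then obtain d where d: "d > 0" "ball x d \<subseteq> U" using U(1) by (meson openE)
      define y where "y = min b (x + d / 2)"
      have y: "x < y" "y \<le> b" "y \<le> x + d / 2" using d x by (auto simp: y_def)
      have "{x..y} \<subseteq> U" using d y by (auto simp: subset_iff dist_real_def)
      then have "U \<inter> {x..y} = {x..y}" by auto
      moreover have "f y - f x \<le> L * (y - x)"
        using lipschitz_onD_real[OF lip, of x y] x y by auto
      moreover have "(L + \<bar>c\<bar>) * (y - x) \<le> M * (y - x)" using M y by (intro mult_right_mono) auto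
      moreover have "- \<bar>c\<bar> * (y - x) \<le> (c + e) * (y - x)" using e y by (intro mult_right_mono) auto
      ultimately have "F x \<le> F y" using inc[of x y] x y by (simp add: algebra_simps)
      then show ?thesis using y by auto
    next
      case False
      then have "a < x" "x \<notin> N" using x U(2) by (cases "x = a"; auto)+
      then obtain D where D: "D \<le> c" "(f has_real_derivative D) (at x)" using der[of x] x by auto
      have "((\<lambda>y. (f y - f x) / (y - x)) \<longlongrightarrow> D) (at_right x)"
        using D(2) unfolding has_field_derivative_iff by (rule tendsto_mono[OF at_le, rotated]) auto
      then have "\<forall>\<^sub>F y in at_right x. (f y - f x) / (y - x) < c + e"
        using D(1) e(1) by (intro order_tendstoD(2)) auto
      moreover have "\<forall>\<^sub>F y in at_right x. x < y \<and> y < b"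
        using x by (intro eventually_conj eventually_at_right_less eventually_at_right_real[THEN eventually_mono]) auto
      ultimately have "\<forall>\<^sub>F y in at_right x. x < y \<and> y < b \<and> (f y - f x) / (y - x) < c + e"
        by eventually_elim auto
      then obtain y where y: "x < y" "y < b" "(f y - f x) / (y - x) < c + e"
        using eventually_happens'[OF trivial_limit_at_right_real[of x]] by blast
      then have "f y - f x \<le> (c + e) * (y - x)" by (simp add: divide_less_eq less_imp_le)
      moreover have "M * measure lborel (U \<inter> {x..y}) \<ge> 0" using M by simp
      ultimately have "F x \<le> F y" using inc[of x y] x y by simp
      then show ?thesis using y by (intro exI[of _ y]) auto
    qed
  qed
  then have "f b - f a \<le> (c + e) * (b - a) + M * measure lborel (U \<inter> {a..b})"
    using inc[of a b] \<open>a \<le> b\<close> by simp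
  also have "M * measure lborel (U \<inter> {a..b}) \<le> M * e"
  proof -
    have "measure lborel (U \<inter> {a..b}) \<le> measure lborel U"
      using Uf UB by (intro measure_mono_fmeasurable) auto
    then show ?thesis using mU' M by (intro mult_left_mono) auto
  qed
  also have "(c + e) * (b - a) + M * e \<le> c * (b - a) + 2 * (M * e)"
    using mult_right_mono[OF M(3), of e] e by (simp add: algebra_simps)
  finally show "f b - f a \<le> c * (b - a) + e0" using e by simp
qed

section \<open>Arcs whose velocity is continuous at the initial time\<close>

lemma lipschitz_vector_differentiable_ae:
  fixes X :: "real \<Rightarrow> 'a::euclidean_space"
  assumes lip: "L-lipschitz_on {a..b} X"
  shows "negligible {t \<in> {a..b}. \<not> X differentiable (at t within {a..b})}"
proof -
  have "negligible {t \<in> {a..b}. \<not> (\<lambda>t. X t \<bullet> i) differentiable (at t within {a..b})}" if "i \<in> Basis" for i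
  proof (rule lipschitz_differentiable_ae)
    show "L-lipschitz_on {a..b} (\<lambda>t. X t \<bullet> i)"
    proof (rule lipschitz_onI)
      fix s t assume st: "s \<in> {a..b}" "t \<in> {a..b}"
      have "\<bar>(X s - X t) \<bullet> i\<bar> \<le> norm (X s - X t)" using that by (rule Basis_le_norm)
      also have "\<dots> \<le> L * dist s t" using lipschitz_onD[OF lip st] by (simp add: dist_norm)
      finally show "dist (X s \<bullet> i) (X t \<bullet> i) \<le> L * dist s t"
        by (simp add: dist_real_def inner_diff_left)
    qed (rule lipschitz_on_nonneg[OF lip])
  qed
  then have "negligible (\<Union>i\<in>Basis. {t \<in> {a..b}. \<not> (\<lambda>t. X t \<bullet> i) differentiable (at t within {a..b})})"
    by (intro negligible_Union) auto
  then show ?thesis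
    by (rule negligible_subset) (auto simp: differentiable_componentwise_within[of X])
qed

text \<open>Pair \<open>X\<close> with the defect \<open>z\<close> itself: the scalar inequality
  becomes |z|^2 <= e (b - a) |z|, and one factor |z| is divided out.\<close>

lemma norm_increment_diff_le:
  fixes X :: "real \<Rightarrow> 'a::euclidean_space"
  assumes lip: "L-lipschitz_on {a..b} X" and "a \<le> b" and N: "negligible N"
    and der: "\<And>t. a < t \<Longrightarrow> t < b \<Longrightarrow> t \<notin> N \<Longrightarrow> \<exists>w. (X has_vector_derivative w) (at t) \<and> norm (w - v) \<le> e"
  shows "norm (X b - X a - (b - a) *\<^sub>R v) \<le> e * (b - a)"
proof -
  define z where "z = X b - X a - (b - a) *\<^sub>R v"
  have lipz: "(L * norm z)-lipschitz_on {a..b} (\<lambda>t. X t \<bullet> z)"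
  proof (rule lipschitz_onI)
    fix s t assume st: "s \<in> {a..b}" "t \<in> {a..b}"
    have "\<bar>(X s - X t) \<bullet> z\<bar> \<le> norm (X s - X t) * norm z" by (rule Cauchy_Schwarz_ineq2)
    also have "\<dots> \<le> L * dist s t * norm z"
      using lipschitz_onD[OF lip st] by (intro mult_right_mono) (auto simp: dist_norm)
    finally show "dist (X s \<bullet> z) (X t \<bullet> z) \<le> L * norm z * dist s t"
      by (simp add: dist_real_def inner_diff_left mult_ac)
  qed (use lipschitz_on_nonneg[OF lip] in simp)
  have "X b \<bullet> z - X a \<bullet> z \<le> (v \<bullet> z + e * norm z) * (b - a)"
  proof (rule increment_le_if_derivative_le_ae[OF lipz \<open>a \<le> b\<close> N])
    fix t assume "a < t" "t < b" "t \<notin> N"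
    then obtain w where w: "(X has_vector_derivative w) (at t)" "norm (w - v) \<le> e" using der by blast
    have "((\<lambda>t. X t \<bullet> z) has_vector_derivative (w \<bullet> z)) (at t)"
      by (rule bounded_linear.has_vector_derivative[OF bounded_linear_inner_left w(1)])
    then have "((\<lambda>t. X t \<bullet> z) has_real_derivative (w \<bullet> z)) (at t)"
      by (simp add: has_real_derivative_iff_has_vector_derivative)
    moreover have "(w - v) \<bullet> z \<le> norm (w - v) * norm z" by (rule norm_cauchy_schwarz)
    then have "w \<bullet> z \<le> v \<bullet> z + e * norm z"
      using mult_right_mono[OF w(2), of "norm z"] by (simp add: inner_diff_left)
    ultimately show "\<exists>D\<le>v \<bullet> z + e * norm z. ((\<lambda>t. X t \<bullet> z) has_real_derivative D) (at t)" by blast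
  qed
  then have "z \<bullet> z \<le> e * (b - a) * norm z"
    by (simp add: z_def algebra_simps inner_diff_left)
  then have "norm z * norm z \<le> e * (b - a) * norm z"
    by (simp add: dot_square_norm power2_eq_square)
  \<comment> \<open>Needed when \<open>z = 0\<close>. The sign of \<open>e\<close> comes from
    \<open>der\<close>: a nonempty open interval is not null, so some time in it supplies a norm
    bounded by \<open>e\<close>.\<close>
  moreover have "e * (b - a) \<ge> 0"
  proof (cases "a < b")
    case True
    have "\<not> {a<..<b} \<subseteq> N"
      using True negligible_subset[OF N, of "{a<..<b}"] by (auto simp: negligible_iff_null_sets null_sets_def)
    then have "e \<ge> 0" using der by (force intro: order_trans[OF norm_ge_zero])
    then show ?thesis using True by simp
  qed (use \<open>a \<le> b\<close> in simp)
  ultimately show ?thesis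
    unfolding z_def[symmetric] by (cases "norm z = 0") (auto simp: mult_le_cancel_right)
qed

text \<open>Turns the essential supremum in \<open>Lip0\<close> into a bound at every time outside a
  null set. The velocity in \<open>Lip0\<close> is existentially quantified; uniqueness of the right
  derivative identifies it with \<open>v\<close>.\<close>

lemma Lip0_derivative_near:
  fixes X :: "real \<Rightarrow> 'a::euclidean_space"
  assumes X: "X \<in> Lip0 T \<Omega>" and "T > 0" and v: "(X has_vector_derivative v) (at_right 0)" and "e > 0"
  obtains d N where "0 < d" "d \<le> T" "negligible N"
    "\<And>t. 0 < t \<Longrightarrow> t < d \<Longrightarrow> t \<notin> N \<Longrightarrow> \<exists>w. (X has_vector_derivative w) (at t) \<and> norm (w - v) \<le> e"
proof -
  obtain L v' where L: "L-lipschitz_on {0..T} X" and v': "(X has_vector_derivative v') (at_right 0)"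
    and lim: "((\<lambda>t. esssup (lebesgue_on {0..t})
                (\<lambda>s. ereal (norm (vector_derivative X (at s within {0..T}) - v')))) \<longlongrightarrow> 0) (at_right 0)"
    using X unfolding Lip0_def by blast
  have "v' = v"
    by (rule vector_derivative_unique_within[OF _ v' v]) simp
  have "\<forall>\<^sub>F t in at_right 0. esssup (lebesgue_on {0..t})
                (\<lambda>s. ereal (norm (vector_derivative X (at s within {0..T}) - v))) < ereal e"
    using order_tendstoD(2)[OF lim, of "ereal e"] \<open>e > 0\<close> \<open>v' = v\<close> by simp
  moreover have "\<forall>\<^sub>F t in at_right 0. 0 < t \<and> t < T"
    using \<open>T > 0\<close> by (auto simp: eventually_at_right_field)
  ultimately have "\<forall>\<^sub>F t in at_right 0. 0 < t \<and> t < T \<and> esssup (lebesgue_on {0..t})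
                (\<lambda>s. ereal (norm (vector_derivative X (at s within {0..T}) - v))) < ereal e"
    by eventually_elim auto
  then obtain d where d: "0 < d" "d < T" "esssup (lebesgue_on {0..d})
                (\<lambda>s. ereal (norm (vector_derivative X (at s within {0..T}) - v))) < ereal e"
    using eventually_happens'[OF trivial_limit_at_right_real[of 0]] by blast
  have "AE s in lebesgue_on {0..d}. norm (vector_derivative X (at s within {0..T}) - v) \<le> e"
    using esssup_AE[of "\<lambda>s. ereal (norm (vector_derivative X (at s within {0..T}) - v))" "lebesgue_on {0..d}"]
  proof (eventually_elim)
    case (elim s)
    then have "ereal (norm (vector_derivative X (at s within {0..T}) - v)) < ereal e"
      using d(3) by (rule order.strict_trans1)
    then show ?case by simp
  qed
  then have "AE s in lebesgue. s \<in> {0..d} \<longrightarrow> norm (vector_derivative X (at s within {0..T}) - v) \<le> e"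
    by (subst (asm) AE_restrict_space_iff) auto
  then have N1: "negligible {s. \<not> (s \<in> {0..d} \<longrightarrow> norm (vector_derivative X (at s within {0..T}) - v) \<le> e)}"
    by (auto simp: eventually_ae_filter negligible_iff_null_sets[symmetric] intro: negligible_subset)
  \<comment> \<open>Times of nondifferentiability are added, since there a bound on
    \<open>vector_derivative\<close> carries no information.\<close>
  define N where "N = {s. \<not> (s \<in> {0..d} \<longrightarrow> norm (vector_derivative X (at s within {0..T}) - v) \<le> e)} \<union>
     {t \<in> {0..T}. \<not> X differentiable (at t within {0..T})}"
  show ?thesis
  proof (rule that[of d N])
    show "negligible N"
      unfolding N_def by (intro negligible_Un N1 lipschitz_vector_differentiable_ae[OF L])
    fix t assume t: "0 < t" "t < d" "t \<notin> N"
    have "X differentiable (at t within {0..T})" using t d by (auto simp: N_def)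
    then have der: "(X has_vector_derivative (vector_derivative X (at t within {0..T}))) (at t within {0..T})"
      by (simp add: vector_derivative_works)
    have "at t within {0..T} = at t" using t d by (intro at_within_interior) auto
    with der show "\<exists>w. (X has_vector_derivative w) (at t) \<and> norm (w - v) \<le> e"
      using t by (auto simp: N_def)
  qed (use d in auto)
qed

section \<open>Superdifferentials of semiconcave functions\<close>

lemma superdiffI:
  assumes "r > 0" and "\<And>y. y \<in> ball x r \<Longrightarrow> u y \<le> u x + p \<bullet> (y - x) + K * (norm (y - x))\<^sup>2"
  shows "p \<in> superdiff \<Omega> u x"
proof -
  have "Limsup (at x within \<Omega>) (\<lambda>y. ereal ((u y - u x - p \<bullet> (y - x)) / norm (y - x))) \<le> ereal e"
    if "e > 0" for e :: real
  proof (rule Limsup_bounded)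
    have "((\<lambda>y. K * norm (y - x)) \<longlongrightarrow> K * norm (x - x)) (at x within \<Omega>)"
      by (intro tendsto_intros)
    then have "\<forall>\<^sub>F y in at x within \<Omega>. K * norm (y - x) < e"
      using that by (intro order_tendstoD(2)) auto
    moreover have "\<forall>\<^sub>F y in at x within \<Omega>. y \<in> ball x r \<and> y \<noteq> x"
      using \<open>r > 0\<close> by (auto simp: eventually_at dist_commute intro!: exI[of _ r])
    ultimately show "\<forall>\<^sub>F y in at x within \<Omega>. ereal ((u y - u x - p \<bullet> (y - x)) / norm (y - x)) \<le> ereal e"
    proof eventually_elim
      case (elim y)
      then have "u y - u x - p \<bullet> (y - x) \<le> K * (norm (y - x))\<^sup>2" using assms(2)[of y] by simp
      also have "\<dots> \<le> e * norm (y - x)"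
        using elim by (simp add: power2_eq_square mult.assoc[symmetric] mult_right_mono)
      finally show ?case using elim by (simp add: divide_le_eq)
    qed
  qed
  then show ?thesis
    unfolding superdiff_def zero_ereal_def by (auto intro: ereal_le_epsilon2)
qed

lemma subdiffI:
  assumes "r > 0" and "\<And>y. y \<in> ball x r \<Longrightarrow> u y \<ge> u x + p \<bullet> (y - x) - K * (norm (y - x))\<^sup>2"
  shows "p \<in> subdiff \<Omega> u x"
proof -
  have "- p \<in> superdiff \<Omega> (\<lambda>y. - u y) x"
    by (rule superdiffI[OF \<open>r > 0\<close>, where K = K]) (use assms(2) in fastforce)
  moreover have "ereal ((- u y - - u x - - p \<bullet> (y - x)) / norm (y - x)) =
      - ereal ((u y - u x - p \<bullet> (y - x)) / norm (y - x))" for y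
    by (simp add: minus_divide_left)
  ultimately show ?thesis
    unfolding superdiff_def subdiff_def
    by (simp only: mem_Collect_eq ereal_Limsup_uminus ereal_uminus_le_0_iff)
qed

text \<open>One constant \<open>C\<close> is fixed, because the distance below which the two arcs
  must coincide is computed from it.\<close>

locale semiconcave_function =
  fixes \<Omega> :: "'a::euclidean_space set" and u :: "'a \<Rightarrow> real" and C :: real
  assumes open_dom: "open \<Omega>" and continuous: "continuous_on \<Omega> u" and C_pos: "C > 0"
    and semiconcavity: "\<And>x y l. \<lbrakk>x \<in> \<Omega>; y \<in> \<Omega>; closed_segment x y \<subseteq> \<Omega>; 0 \<le> l; l \<le> 1\<rbrakk> \<Longrightarrow>
        l * u x + (1 - l) * u y - u (l *\<^sub>R x + (1 - l) *\<^sub>R y) \<le> C / 2 * l * (1 - l) * (norm (x - y))\<^sup>2"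
begin

abbreviation "D \<equiv> superdiff \<Omega> u"

text \<open>Semiconcavity makes the infinitesimal condition quantitative with the same
  \<open>C\<close> at all points; closedness, local bounds and monotonicity all rest on this
  uniformity. An excess at \<open>y\<close> is inherited, in proportion to the distance, by points
  of the segment near \<open>x\<close>, against the limit superior; \<kappa> is that excess per unit
  length.\<close>

lemma superdiff_upper_bound:
  assumes p: "p \<in> D x" and ball: "ball x r \<subseteq> \<Omega>" and y: "y \<in> ball x r"
  shows "u y \<le> u x + p \<bullet> (y - x) + C / 2 * (norm (y - x))\<^sup>2"
proof (rule ccontr)
  assume less: "\<not> ?thesis"
  define d where "d = y - x"
  define \<kappa> where "\<kappa> = (u y - u x - p \<bullet> d - C / 2 * (norm d)\<^sup>2) / norm d"
  have pos: "u y - u x - p \<bullet> d - C / 2 * (norm d)\<^sup>2 > 0" using less by (simp add: d_def)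
  then have "d \<noteq> 0" by (auto simp: d_def)
  then have "\<kappa> > 0" using pos by (simp add: \<kappa>_def)
  have r: "r > 0" using y zero_le_dist[of x y] by (simp only: mem_ball)
  have xy: "x \<in> \<Omega>" "y \<in> \<Omega>" "closed_segment y x \<subseteq> ball x r"
    using ball y r closed_segment_subset[OF y _ convex_ball, of x] by auto
  have "\<forall>\<^sub>F z in at x within \<Omega>. ereal ((u z - u x - p \<bullet> (z - x)) / norm (z - x)) < ereal \<kappa>"
    using p \<open>\<kappa> > 0\<close> unfolding superdiff_def by (intro Limsup_lessD) (auto intro: le_less_trans)
  then obtain \<delta> where \<delta>: "\<delta> > 0"
    "\<And>z. z \<in> \<Omega> \<Longrightarrow> z \<noteq> x \<Longrightarrow> dist z x < \<delta> \<Longrightarrow> (u z - u x - p \<bullet> (z - x)) / norm (z - x) < \<kappa>"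
    by (auto simp: eventually_at)
  define s where "s = min (1/2) (\<delta> / (2 * norm d))"
  have s: "0 < s" "s < 1" "s * norm d < \<delta>"
    using \<delta> \<open>d \<noteq> 0\<close> by (auto simp: s_def min_def field_simps)
  define z where "z = x + s *\<^sub>R d"
  have zeq: "z = s *\<^sub>R y + (1 - s) *\<^sub>R x" by (simp add: z_def d_def algebra_simps)
  have "z \<in> closed_segment y x"
    unfolding zeq in_segment using s by (intro exI[of _ "1 - s"]) auto
  then have "z \<in> \<Omega>" using xy ball by blast
  moreover have "z \<noteq> x" using s \<open>d \<noteq> 0\<close> by (simp add: z_def)
  moreover have "dist z x < \<delta>" using s by (simp add: z_def dist_norm)
  ultimately have "(u z - u x - p \<bullet> (z - x)) / norm (z - x) < \<kappa>" using \<delta> by blast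
  then have "(u z - u x - s * (p \<bullet> d)) / (s * norm d) < \<kappa>" using s by (simp add: z_def)
  then have "u z - u x - s * (p \<bullet> d) < \<kappa> * (s * norm d)" using s \<open>d \<noteq> 0\<close> by (simp add: divide_less_eq)
  also have "\<kappa> * (s * norm d) = s * (u y - u x - p \<bullet> d - C / 2 * (norm d)\<^sup>2)"
    using \<open>d \<noteq> 0\<close> by (simp add: \<kappa>_def)
  finally have 1: "u z < u x + s * (u y - u x - C / 2 * (norm d)\<^sup>2)" by (simp add: algebra_simps)
  have "s * u y + (1 - s) * u x - u z \<le> C / 2 * s * (1 - s) * (norm (y - x))\<^sup>2"
    unfolding zeq using xy ball s by (intro semiconcavity) auto
  also have "\<dots> \<le> s * (C / 2 * (norm d)\<^sup>2)"
  proof -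
    have "(1 - s) * (C / 2 * s * (norm d)\<^sup>2) \<le> 1 * (C / 2 * s * (norm d)\<^sup>2)"
      using s C_pos by (intro mult_right_mono) auto
    then show ?thesis by (simp add: d_def mult_ac)
  qed
  finally show False using 1 by (simp add: algebra_simps)
qed

lemma superdiff_iff:
  assumes "r > 0" "ball x r \<subseteq> \<Omega>"
  shows "p \<in> D x \<longleftrightarrow> (\<forall>y\<in>ball x r. u y \<le> u x + p \<bullet> (y - x) + C / 2 * (norm (y - x))\<^sup>2)"
  using superdiff_upper_bound[OF _ assms(2)] superdiffI[OF assms(1), of x u p "C / 2"] by blast

lemma convex_superdiff:
  assumes "x \<in> \<Omega>"
  shows "convex (D x)"
proof -
  obtain r where r: "r > 0" "ball x r \<subseteq> \<Omega>" using open_dom assms by (meson openE)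
  show ?thesis
  proof (rule convexI)
    fix p q and a b :: real
    assume pq: "p \<in> D x" "q \<in> D x" and ab: "0 \<le> a" "0 \<le> b" "a + b = 1"
    show "a *\<^sub>R p + b *\<^sub>R q \<in> D x"
      unfolding superdiff_iff[OF r]
    proof
      fix y assume y: "y \<in> ball x r"
      have "a * (u y - u x - C / 2 * (norm (y - x))\<^sup>2) + b * (u y - u x - C / 2 * (norm (y - x))\<^sup>2)
         \<le> a * (p \<bullet> (y - x)) + b * (q \<bullet> (y - x))"
        using superdiff_upper_bound[OF pq(1) r(2) y] superdiff_upper_bound[OF pq(2) r(2) y] ab
        by (intro add_mono mult_left_mono) auto
      moreover have "a * z + b * z = z" for z :: real using ab by (metis mult_1 distrib_right)
      ultimately show "u y \<le> u x + (a *\<^sub>R p + b *\<^sub>R q) \<bullet> (y - x) + C / 2 * (norm (y - x))\<^sup>2"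
        by (simp add: inner_add_left)
    qed
  qed
qed

text \<open>The quadratic inequality has a fixed constant and so survives the limit. Radius
  \<open>R / 4\<close> for \<open>y\<close> ensures that \<open>y\<close> lies in the ball of radius
  \<open>R / 2\<close> about \<open>X k\<close>, which is still inside the domain.\<close>

lemma superdiff_limit:
  assumes x: "x \<in> \<Omega>" and X: "X \<longlonglongrightarrow> x" and P: "\<And>k::nat. P k \<in> D (X k)" "P \<longlonglongrightarrow> p"
  shows "p \<in> D x"
proof -
  obtain R where R: "R > 0" "ball x R \<subseteq> \<Omega>" using open_dom x by (meson openE)
  have cont: "isCont u x" using continuous open_dom x by (simp add: continuous_on_eq_continuous_at)
  have "u y \<le> u x + p \<bullet> (y - x) + C / 2 * (norm (y - x))\<^sup>2" if y: "y \<in> ball x (R / 4)" for y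
  proof (rule LIMSEQ_le_const)
    show "(\<lambda>k. u (X k) + P k \<bullet> (y - X k) + C / 2 * (norm (y - X k))\<^sup>2) \<longlonglongrightarrow>
        u x + p \<bullet> (y - x) + C / 2 * (norm (y - x))\<^sup>2"
      by (intro tendsto_intros isCont_tendsto_compose[OF cont] X P(2))
    have "\<forall>\<^sub>F k in sequentially. dist (X k) x < R / 4" using X R by (intro tendstoD) auto
    then obtain n where n: "\<And>k. k \<ge> n \<Longrightarrow> dist (X k) x < R / 4" by (auto simp: eventually_sequentially)
    have "u y \<le> u (X k) + P k \<bullet> (y - X k) + C / 2 * (norm (y - X k))\<^sup>2" if "k \<ge> n" for k
    proof (rule superdiff_upper_bound[OF P(1)])
      show "ball (X k) (R / 2) \<subseteq> \<Omega>"
      proof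
        fix z assume "z \<in> ball (X k) (R / 2)"
        then have "dist x z < R"
          using n[OF that] R dist_triangle[of x z "X k"] by (simp add: dist_commute)
        then show "z \<in> \<Omega>" using R by auto
      qed
      show "y \<in> ball (X k) (R / 2)"
        using n[OF that] y dist_triangle[of "X k" y x] by simp
    qed
    then show "\<exists>N. \<forall>k\<ge>N. u y \<le> u (X k) + P k \<bullet> (y - X k) + C / 2 * (norm (y - X k))\<^sup>2" by blast
  qed
  moreover have "0 < R / 4" using R by simp
  ultimately show ?thesis by (intro superdiffI)
qed

text \<open>Walking distance \<open>r\<close> from \<open>x\<close> against \<open>p\<close> lowers
  \<open>u\<close> by at least \<open>r * norm p\<close> up to a quadratic error, but
  \<open>u\<close> is bounded on a compact ball. Radius \<open>3 * r\<close> leaves room for a ball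
  of radius \<open>2 * r\<close> about each point of \<open>ball x0 r\<close>, as needed to compare
  two such points.\<close>

lemma superdiff_bounded_near:
  assumes x0: "x0 \<in> \<Omega>"
  obtains r M where "r > 0" "ball x0 (3 * r) \<subseteq> \<Omega>" "M > 0" "\<And>x p. x \<in> ball x0 r \<Longrightarrow> p \<in> D x \<Longrightarrow> norm p \<le> M"
proof -
  obtain R where R: "R > 0" "cball x0 R \<subseteq> \<Omega>" using open_dom x0 by (meson open_contains_cball)
  define r where "r = R / 3"
  have r: "r > 0" "cball x0 (3 * r) \<subseteq> \<Omega>" using R by (auto simp: r_def)
  have "compact (u ` cball x0 (3 * r))"
    using r by (intro compact_continuous_image continuous_on_subset[OF continuous]) auto
  then obtain B where B: "\<And>x. x \<in> cball x0 (3 * r) \<Longrightarrow> \<bar>u x\<bar> \<le> B"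
    by (fastforce dest!: compact_imp_bounded simp: bounded_iff)
  have "B \<ge> 0" using B[of x0] r by auto
  define M where "M = (2 * B + C / 2 * r\<^sup>2) / r"
  show ?thesis
  proof (rule that[of r M])
    show "r > 0" by fact
    show "ball x0 (3 * r) \<subseteq> \<Omega>" using r by (meson ball_subset_cball order_trans)
    show "M > 0" using r C_pos \<open>B \<ge> 0\<close> by (simp add: M_def add_nonneg_pos)
    fix x p assume x: "x \<in> ball x0 r" and p: "p \<in> D x"
    have sub: "ball x (2 * r) \<subseteq> cball x0 (3 * r)"
    proof
      fix z assume "z \<in> ball x (2 * r)"
      then show "z \<in> cball x0 (3 * r)" using x dist_triangle[of x0 z x] by simp
    qed
    show "norm p \<le> M"
    proof (cases "p = 0")
      case False
      define y where "y = x - (r / norm p) *\<^sub>R p"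
      have ny: "norm (y - x) = r" using r False by (simp add: y_def)
      have y: "y \<in> ball x (2 * r)" using ny r by (simp add: dist_norm norm_minus_commute)
      have "u y \<le> u x + p \<bullet> (y - x) + C / 2 * (norm (y - x))\<^sup>2"
        using p sub r y by (intro superdiff_upper_bound[of p x "2 * r"]) auto
      also have "p \<bullet> (y - x) = - (r * norm p)"
        using False by (simp add: y_def dot_square_norm power2_eq_square)
      finally have "r * norm p \<le> u x - u y + C / 2 * r\<^sup>2" using ny by simp
      also have "u x - u y \<le> 2 * B"
        using B[of x] B[of y] sub y r by (auto simp: subset_iff abs_le_iff)
      finally show ?thesis using r by (simp add: M_def pos_le_divide_eq mult.commute)
    qed (use \<open>M > 0\<close> in simp)
  qed
qed

text \<open>Compactness of supergradients near \<open>x\<close> plus the closed graph. This later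
  extends a property from almost every time to every time.\<close>

lemma superdiff_halfspace_limit:
  assumes x: "x \<in> \<Omega>" and X: "X \<longlonglongrightarrow> x" and p: "\<And>k::nat. \<exists>p\<in>D (X k). a \<le> p \<bullet> m"
  shows "\<exists>p\<in>D x. a \<le> p \<bullet> m"
proof -
  obtain P where P: "\<And>k. P k \<in> D (X k)" "\<And>k. a \<le> P k \<bullet> m" using p by metis
  obtain r M where r: "r > 0" and M: "\<And>y p. y \<in> ball x r \<Longrightarrow> p \<in> D y \<Longrightarrow> norm p \<le> M"
    using superdiff_bounded_near[OF x] by metis
  obtain n where n: "\<And>k. k \<ge> n \<Longrightarrow> X k \<in> ball x r"
    using tendstoD[OF X r] by (auto simp: eventually_sequentially dist_commute)
  have "\<forall>k. P (k + n) \<in> cball 0 M" using M[OF n P(1)] by simp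
  then obtain q \<phi> where \<phi>: "strict_mono (\<phi> :: nat \<Rightarrow> nat)" "((\<lambda>k. P (k + n)) \<circ> \<phi>) \<longlonglongrightarrow> q"
    using compact_imp_seq_compact[OF compact_cball[of "0::'a" M]] unfolding seq_compact_def by metis
  have \<psi>: "strict_mono (\<lambda>k. \<phi> k + n)" using \<phi>(1) by (auto simp: strict_mono_def)
  have Plim: "(\<lambda>k. P (\<phi> k + n)) \<longlonglongrightarrow> q" using \<phi>(2) by (simp add: o_def)
  have Xlim: "(\<lambda>k. X (\<phi> k + n)) \<longlonglongrightarrow> x" using LIMSEQ_subseq_LIMSEQ[OF X \<psi>] by (simp add: o_def)
  have "q \<in> D x" by (rule superdiff_limit[OF x Xlim P(1) Plim])
  moreover have "a \<le> q \<bullet> m"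
    by (rule LIMSEQ_le_const[of "\<lambda>k. P (\<phi> k + n) \<bullet> m"]) (use P(2) in \<open>auto intro!: tendsto_intros Plim\<close>)
  ultimately show ?thesis by blast
qed

text \<open>Add the quadratic upper bounds of \<open>p\<close> at \<open>x\<close> and of
  \<open>q\<close> at \<open>y\<close>; the values of \<open>u\<close> cancel and
  \<open>C / 2\<close> occurs twice.\<close>

lemma superdiff_monotone:
  assumes "ball z (3 * r) \<subseteq> \<Omega>" and xy: "x \<in> ball z r" "y \<in> ball z r" and p: "p \<in> D x" and q: "q \<in> D y"
  shows "(p - q) \<bullet> (x - y) \<le> C * (norm (x - y))\<^sup>2"
proof -
  have sub: "ball w (2 * r) \<subseteq> \<Omega>" if "w \<in> ball z r" for w
  proof
    fix a assume "a \<in> ball w (2 * r)"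
    then have "a \<in> ball z (3 * r)" using that dist_triangle[of z a w] by simp
    then show "a \<in> \<Omega>" using assms(1) by blast
  qed
  have d: "dist x y < 2 * r" using xy dist_triangle[of x y z] by (simp add: dist_commute)
  have "u y \<le> u x + p \<bullet> (y - x) + C / 2 * (norm (y - x))\<^sup>2"
    using d by (intro superdiff_upper_bound[OF p sub[OF xy(1)]]) simp
  moreover have "u x \<le> u y + q \<bullet> (x - y) + C / 2 * (norm (x - y))\<^sup>2"
    using d by (intro superdiff_upper_bound[OF q sub[OF xy(2)]]) (simp add: dist_commute)
  ultimately show ?thesis
    by (simp add: norm_minus_commute[of y x] inner_diff_left inner_diff_right algebra_simps)
qed

text \<open>Approaching \<open>x\<close> in direction \<theta>' leads into the face of
  \<open>D x\<close> exposed by \<theta>'. Monotonicity between \<open>x\<close> and the approaching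
  point, divided by \<tau>, leaves an error of order \<tau>.\<close>

lemma superdiff_limit_in_face:
  assumes x: "x \<in> \<Omega>" and \<tau>: "\<And>k::nat. \<tau> k > 0" "\<tau> \<longlonglongrightarrow> 0" and \<theta>: "\<theta> \<longlonglongrightarrow> \<theta>'"
    and P: "\<And>k. P k \<in> D (x + \<tau> k *\<^sub>R \<theta> k)" "P \<longlonglongrightarrow> p"
  shows "p \<in> D x" "\<And>q. q \<in> D x \<Longrightarrow> p \<bullet> \<theta>' \<le> q \<bullet> \<theta>'"
proof -
  have "(\<lambda>k. x + \<tau> k *\<^sub>R \<theta> k) \<longlonglongrightarrow> x + 0 *\<^sub>R \<theta>'" by (intro tendsto_intros \<tau> \<theta>)
  then have lim: "(\<lambda>k. x + \<tau> k *\<^sub>R \<theta> k) \<longlonglongrightarrow> x" by simp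
  show "p \<in> D x" by (rule superdiff_limit[OF x lim P])
  fix q assume q: "q \<in> D x"
  obtain r where r: "r > 0" "ball x (3 * r) \<subseteq> \<Omega>" using superdiff_bounded_near[OF x] by metis
  have "\<forall>\<^sub>F k in sequentially. (P k - q) \<bullet> \<theta> k \<le> C * \<tau> k * (norm (\<theta> k))\<^sup>2"
    using tendstoD[OF lim r(1)]
  proof eventually_elim
    case (elim k)
    have "(P k - q) \<bullet> (x + \<tau> k *\<^sub>R \<theta> k - x) \<le> C * (norm (x + \<tau> k *\<^sub>R \<theta> k - x))\<^sup>2"
      using elim r P(1) q by (intro superdiff_monotone[OF r(2)]) (auto simp: dist_commute)
    then have "\<tau> k * ((P k - q) \<bullet> \<theta> k) \<le> \<tau> k * (C * \<tau> k * (norm (\<theta> k))\<^sup>2)"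
      by (simp add: power_mult_distrib power2_eq_square mult_ac)
    then show ?case using \<tau>(1)[of k] by simp
  qed
  moreover have "(\<lambda>k. (P k - q) \<bullet> \<theta> k) \<longlonglongrightarrow> (p - q) \<bullet> \<theta>'" by (intro tendsto_intros P \<theta>)
  moreover have "(\<lambda>k. C * \<tau> k * (norm (\<theta> k))\<^sup>2) \<longlonglongrightarrow> C * 0 * (norm \<theta>')\<^sup>2" by (intro tendsto_intros \<tau> \<theta>)
  ultimately have "(p - q) \<bullet> \<theta>' \<le> C * 0 * (norm \<theta>')\<^sup>2"
    by (intro tendsto_le[OF sequentially_bot])
  then show "p \<bullet> \<theta>' \<le> q \<bullet> \<theta>'" by (simp add: inner_diff_left)
qed

text \<open>Touching from below by a steep paraboloid centred at \<open>z\<close> produces a point of differentiability.\<close>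

lemma exists_differential_in_ball:
  assumes "r > 0" and cb: "cball z r \<subseteq> \<Omega>"
  obtains y p where "y \<in> ball z r" "p \<in> D y" "p \<in> subdiff \<Omega> u y"
proof -
  have cont: "continuous_on (cball z r) u" using cb by (rule continuous_on_subset[OF continuous])
  then have "compact (u ` cball z r)" by (intro compact_continuous_image) auto
  then obtain B where B: "\<And>x. x \<in> cball z r \<Longrightarrow> \<bar>u x\<bar> \<le> B"
    by (fastforce dest!: compact_imp_bounded simp: bounded_iff)
  have "B \<ge> 0" using B[of z] \<open>r > 0\<close> by auto
  \<comment> \<open>So steep that \<open>K * r\<^sup>2\<close> exceeds \<open>2 * B\<close>, a bound
    for the oscillation of \<open>u\<close>; the minimiser therefore cannot lie on the boundary
    sphere.\<close>
  define K where "K = (2 * B + 1) / r\<^sup>2"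
  have K: "K > 0" "K * r\<^sup>2 = 2 * B + 1" using \<open>r > 0\<close> \<open>B \<ge> 0\<close> by (auto simp: K_def add_nonneg_pos)
  have contK: "continuous_on (cball z r) (\<lambda>y. u y + K * (norm (y - z))\<^sup>2)" by (intro continuous_intros cont)
  have "cball z r \<noteq> {}" using \<open>r > 0\<close> by simp
  from continuous_attains_inf[OF compact_cball this contK] obtain y where y: "y \<in> cball z r"
    and min: "\<And>w. w \<in> cball z r \<Longrightarrow> u y + K * (norm (y - z))\<^sup>2 \<le> u w + K * (norm (w - z))\<^sup>2"
    by blast
  have "K * (norm (y - z))\<^sup>2 \<le> 2 * B" using min[of z] B[of y] B[of z] y \<open>r > 0\<close> by (simp add: abs_le_iff)
  then have "K * (norm (y - z))\<^sup>2 < K * r\<^sup>2" using K by simp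
  then have "(norm (y - z))\<^sup>2 < r\<^sup>2" using K(1) by (simp only: mult_less_cancel_left_pos)
  then have yb: "y \<in> ball z r" using \<open>r > 0\<close> by (simp add: dist_norm norm_minus_commute power_less_imp_less_base)
  then obtain \<rho> where \<rho>: "\<rho> > 0" "ball y \<rho> \<subseteq> ball z r" by (meson open_ball openE)
  define p where "p = - (2 * K) *\<^sub>R (y - z)"
  have low: "u w \<ge> u y + p \<bullet> (w - y) - K * (norm (w - y))\<^sup>2" if "w \<in> ball y \<rho>" for w
  proof -
    have "u y + K * (norm (y - z))\<^sup>2 \<le> u w + K * (norm (w - z))\<^sup>2"
      using that \<rho>(2) by (intro min) auto
    moreover have "w - z = (y - z) + (w - y)" by simp
    then have "(norm (w - z))\<^sup>2 = (norm (y - z))\<^sup>2 + 2 * ((y - z) \<bullet> (w - y)) + (norm (w - y))\<^sup>2"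
      by (simp only: power2_norm_eq_inner inner_add_left inner_add_right inner_commute[of "w - y" "y - z"])
    moreover have "p \<bullet> (w - y) = - (2 * K * ((y - z) \<bullet> (w - y)))" by (simp add: p_def)
    ultimately show ?thesis by (simp add: algebra_simps)
  qed
  show ?thesis
  proof (rule that[OF yb])
    show "p \<in> subdiff \<Omega> u y" by (rule subdiffI[OF \<rho>(1) low])
    show "p \<in> D y"
    proof (rule superdiffI[OF \<rho>(1), where K = "K + C"])
      fix w assume w: "w \<in> ball y \<rho>"
      \<comment> \<open>The reflection of \<open>w\<close> in \<open>y\<close>. Semiconcavity at the
        midpoint \<open>y\<close> turns the lower bound at \<open>w'\<close> into an upper bound at
        \<open>w\<close>, so the touching slope is also a supergradient.\<close>
      define w' where "w' = 2 *\<^sub>R y - w"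
      have d: "w' - y = - (w - y)" by (simp add: w'_def scaleR_2)
      then have w': "w' \<in> ball y \<rho>" using w by (metis dist_norm mem_ball norm_minus_cancel norm_minus_commute)
      have "closed_segment w w' \<subseteq> ball y \<rho>" using w w' by (intro closed_segment_subset) auto
      then have seg: "closed_segment w w' \<subseteq> \<Omega>" using \<rho>(2) cb ball_subset_cball by blast
      have "1/2 * u w + (1 - 1/2) * u w' - u ((1/2) *\<^sub>R w + (1 - 1/2) *\<^sub>R w') \<le> C / 2 * (1/2) * (1 - 1/2) * (norm (w - w'))\<^sup>2"
        using seg by (intro semiconcavity) auto
      moreover have "(1/2) *\<^sub>R w + (1 - 1/2) *\<^sub>R w' = y" by (simp add: w'_def algebra_simps)
      moreover have "w - w' = 2 *\<^sub>R (w - y)" by (simp add: w'_def algebra_simps scaleR_2)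
      then have "(norm (w - w'))\<^sup>2 = 4 * (norm (w - y))\<^sup>2" by (simp add: power_mult_distrib)
      ultimately have "u w \<le> 2 * u y - u w' + C * (norm (w - y))\<^sup>2" by simp
      moreover have "u w' \<ge> u y - p \<bullet> (w - y) - K * (norm (w - y))\<^sup>2"
        using low[OF w'] unfolding d norm_minus_cancel inner_minus_right by simp
      ultimately show "u w \<le> u y + p \<bullet> (w - y) + (K + C) * (norm (w - y))\<^sup>2"
        by (simp add: algebra_simps)
    qed
  qed
qed

text \<open>Differentials are sampled along the ray in direction \<theta>, in balls of radius
  \<tau>^2. This is of smaller order than \<tau>, so the sampled points still approach
  \<open>x\<close> in direction \<theta>, and that direction selects the face containing the
  limit.\<close>

lemma exists_limit_differential_minimising:
  assumes x: "x \<in> \<Omega>"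
  obtains Y P p where "\<And>k::nat. P k \<in> subdiff \<Omega> u (Y k)" "\<And>k. Y k \<in> \<Omega>" "Y \<longlonglongrightarrow> x" "P \<longlonglongrightarrow> p"
    "p \<in> D x" "\<And>q. q \<in> D x \<Longrightarrow> p \<bullet> \<theta> \<le> q \<bullet> \<theta>"
proof -
  obtain r M where r: "r > 0" "ball x (3 * r) \<subseteq> \<Omega>" and M: "\<And>y p. y \<in> ball x r \<Longrightarrow> p \<in> D y \<Longrightarrow> norm p \<le> M"
    using superdiff_bounded_near[OF x] by metis
  \<comment> \<open>Ensures \<tau> |\<theta>| + \<tau>^2 < r whenever 0 < \<tau> <= c, so all
    sampling balls lie where supergradients are bounded.\<close>
  define c where "c = min 1 (r / (norm \<theta> + 2))"
  have n\<theta>: "norm \<theta> + 2 > 0" by (simp add: add_nonneg_pos)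
  have c: "0 < c" "c \<le> 1" "c * (norm \<theta> + 2) \<le> r"
    using r n\<theta> by (auto simp: c_def min_def divide_simps)
  define \<tau> where "\<tau> k = c / real (Suc k)" for k
  have \<tau>: "\<tau> k > 0" "\<tau> k \<le> c" for k using c by (auto simp: \<tau>_def divide_le_eq)
  have \<tau>0: "\<tau> \<longlonglongrightarrow> 0"
    unfolding \<tau>_def by (intro real_tendsto_divide_at_top[OF tendsto_const] filterlim_compose[OF filterlim_real_sequentially] filterlim_Suc)
  have sub: "cball (x + \<tau> k *\<^sub>R \<theta>) ((\<tau> k)\<^sup>2) \<subseteq> ball x r" for k
  proof
    fix y assume "y \<in> cball (x + \<tau> k *\<^sub>R \<theta>) ((\<tau> k)\<^sup>2)"
    then have "dist (x + \<tau> k *\<^sub>R \<theta>) y \<le> (\<tau> k)\<^sup>2" by simp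
    moreover have "dist x y \<le> dist x (x + \<tau> k *\<^sub>R \<theta>) + dist (x + \<tau> k *\<^sub>R \<theta>) y" by (rule dist_triangle)
    moreover have "dist x (x + \<tau> k *\<^sub>R \<theta>) = \<tau> k * norm \<theta>" using \<tau>[of k] by (simp add: dist_norm)
    moreover have "(\<tau> k)\<^sup>2 \<le> \<tau> k * 1" unfolding power2_eq_square using \<tau>[of k] c by (intro mult_left_mono) auto
    moreover have "\<tau> k * (norm \<theta> + 2) \<le> c * (norm \<theta> + 2)" using \<tau>[of k] n\<theta> by (intro mult_right_mono) auto
    ultimately show "y \<in> ball x r" using c(3) \<tau>(1)[of k] by (simp add: algebra_simps)
  qed
  have sub': "ball x r \<subseteq> \<Omega>" using r by (intro order_trans[OF _ r(2)] subset_ball) auto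
  have "\<exists>y p. y \<in> ball (x + \<tau> k *\<^sub>R \<theta>) ((\<tau> k)\<^sup>2) \<and> p \<in> D y \<and> p \<in> subdiff \<Omega> u y" for k
    using exists_differential_in_ball[of "(\<tau> k)\<^sup>2" "x + \<tau> k *\<^sub>R \<theta>"] sub[of k] sub' \<tau>[of k]
    by (metis less_le_not_le order_trans zero_less_power)
  then obtain Y P where Y: "\<And>k. Y k \<in> ball (x + \<tau> k *\<^sub>R \<theta>) ((\<tau> k)\<^sup>2)"
    and P: "\<And>k. P k \<in> D (Y k)" "\<And>k. P k \<in> subdiff \<Omega> u (Y k)" by metis
  have Yb: "Y k \<in> ball x r" for k using Y[of k] sub[of k] ball_subset_cball by blast
  define \<theta>' where "\<theta>' k = (1 / \<tau> k) *\<^sub>R (Y k - x)" for k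
  have Yeq: "Y k = x + \<tau> k *\<^sub>R \<theta>' k" for k using \<tau>(1)[of k] by (simp add: \<theta>'_def)
  have "norm (\<theta>' k - \<theta>) \<le> \<tau> k" for k
  proof -
    have "\<theta>' k - \<theta> = (1 / \<tau> k) *\<^sub>R (Y k - (x + \<tau> k *\<^sub>R \<theta>))"
      using \<tau>(1)[of k] by (simp add: \<theta>'_def algebra_simps)
    then have "norm (\<theta>' k - \<theta>) = norm (Y k - (x + \<tau> k *\<^sub>R \<theta>)) / \<tau> k" using \<tau>(1)[of k] by simp
    also have "\<dots> \<le> (\<tau> k)\<^sup>2 / \<tau> k"
      using Y[of k] \<tau>(1)[of k] by (intro divide_right_mono) (auto simp: dist_norm norm_minus_commute)
    finally show ?thesis using \<tau>(1)[of k] by (simp add: power2_eq_square)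
  qed
  then have "(\<lambda>k. \<theta>' k - \<theta>) \<longlonglongrightarrow> 0"
    by (intro Lim_null_comparison[OF _ \<tau>0] always_eventually) auto
  then have \<theta>': "\<theta>' \<longlonglongrightarrow> \<theta>" by (simp add: LIM_zero_iff)
  have "\<forall>k. P k \<in> cball 0 M" using M[OF Yb P(1)] by simp
  then obtain p \<phi> where \<phi>: "strict_mono (\<phi> :: nat \<Rightarrow> nat)" "(P \<circ> \<phi>) \<longlonglongrightarrow> p"
    using compact_imp_seq_compact[OF compact_cball[of "0::'a" M]] unfolding seq_compact_def by metis
  have P': "P (\<phi> k) \<in> D (x + \<tau> (\<phi> k) *\<^sub>R \<theta>' (\<phi> k))" for k using P(1)[of "\<phi> k"] Yeq by simp
  have lims: "(\<lambda>k. \<tau> (\<phi> k)) \<longlonglongrightarrow> 0" "(\<lambda>k. \<theta>' (\<phi> k)) \<longlonglongrightarrow> \<theta>"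
    using LIMSEQ_subseq_LIMSEQ[OF \<tau>0 \<phi>(1)] LIMSEQ_subseq_LIMSEQ[OF \<theta>' \<phi>(1)] by (auto simp: o_def)
  have P2: "(\<lambda>k. P (\<phi> k)) \<longlonglongrightarrow> p" using \<phi>(2) by (simp add: o_def)
  note face = superdiff_limit_in_face[OF x \<tau>(1) lims P' P2]
  show ?thesis
  proof (rule that[of "\<lambda>k. P (\<phi> k)" "\<lambda>k. Y (\<phi> k)" p])
    have "(\<lambda>k. x + \<tau> (\<phi> k) *\<^sub>R \<theta>' (\<phi> k)) \<longlonglongrightarrow> x + 0 *\<^sub>R \<theta>" by (intro tendsto_intros lims)
    then show "(\<lambda>k. Y (\<phi> k)) \<longlonglongrightarrow> x" using Yeq by simp
  qed (use P face P2 Yb sub' in auto)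
qed

lemma superdiff_nonempty:
  assumes "x \<in> \<Omega>"
  shows "D x \<noteq> {}"
  \<comment> \<open>In direction 0 the minimality clause is trivial and only existence
    remains.\<close>
  by (rule exists_limit_differential_minimising[OF assms, of 0]) blast

text \<open>Supergradients exist at every point and are locally bounded; their upper bounds at both
  points control both signs of the increment. This makes \<open>u\<close> Lipschitz along a
  Lipschitz arc near \<open>x0\<close>.\<close>

lemma lipschitz_near:
  assumes "x0 \<in> \<Omega>"
  obtains r L where "r > 0" "ball x0 r \<subseteq> \<Omega>" "L-lipschitz_on (ball x0 r) u"
proof -
  obtain r M where r: "r > 0" "ball x0 (3 * r) \<subseteq> \<Omega>" "M > 0" and M: "\<And>x p. x \<in> ball x0 r \<Longrightarrow> p \<in> D x \<Longrightarrow> norm p \<le> M"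
    using superdiff_bounded_near[OF assms] by metis
  have sub: "ball x0 r \<subseteq> \<Omega>" using r by (intro order_trans[OF _ r(2)] subset_ball) auto
  have le: "u y - u x \<le> (M + C * r) * dist x y" if xy: "x \<in> ball x0 r" "y \<in> ball x0 r" for x y
  proof -
    obtain p where p: "p \<in> D x" using superdiff_nonempty[of x] sub xy by blast
    have d: "dist x y < 2 * r" using xy dist_triangle[of x y x0] by (simp add: dist_commute)
    have "ball x (2 * r) \<subseteq> \<Omega>"
    proof
      fix a assume "a \<in> ball x (2 * r)"
      then have "a \<in> ball x0 (3 * r)" using xy dist_triangle[of x0 a x] by simp
      then show "a \<in> \<Omega>" using r by blast
    qed
    then have "u y \<le> u x + p \<bullet> (y - x) + C / 2 * (norm (y - x))\<^sup>2"
      using d by (intro superdiff_upper_bound[OF p, of "2 * r"]) auto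
    moreover have "p \<bullet> (y - x) \<le> M * dist x y"
    proof -
      have "p \<bullet> (y - x) \<le> norm p * norm (y - x)" by (rule norm_cauchy_schwarz)
      also have "\<dots> \<le> M * norm (y - x)" using M[OF xy(1) p] by (rule mult_right_mono) simp
      finally show ?thesis by (simp add: dist_norm norm_minus_commute)
    qed
    moreover have "C / 2 * (norm (y - x))\<^sup>2 \<le> C / 2 * (2 * r * dist x y)"
      using d C_pos by (intro mult_left_mono) (auto simp: power2_eq_square dist_norm norm_minus_commute intro!: mult_right_mono)
    ultimately show ?thesis by (simp add: algebra_simps)
  qed
  have "(M + C * r)-lipschitz_on (ball x0 r) u"
  proof (rule lipschitz_onI)
    fix x y assume "x \<in> ball x0 r" "y \<in> ball x0 r"
    then show "dist (u x) (u y) \<le> (M + C * r) * dist x y"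
      using le[of x y] le[of y x] by (auto simp: dist_real_def dist_commute)
  qed (use r C_pos in simp)
  then show ?thesis using that[of r] r sub by blast
qed

text \<open>The difference \<open>f\<close> of the two sides of the supergradient inequality along the arc is
  maximal at \<open>t\<close>, so its derivative vanishes there.\<close>

lemma superdiff_inner_velocity:
  assumes x: "X t \<in> \<Omega>" and X: "(X has_vector_derivative w) (at t)"
    and uX: "((\<lambda>s. u (X s)) has_real_derivative d) (at t)" and p: "p \<in> D (X t)"
  shows "p \<bullet> w = d"
proof -
  obtain r where r: "r > 0" "ball (X t) r \<subseteq> \<Omega>" using open_dom x by (meson openE)
  define f where "f s = u (X s) - u (X t) - p \<bullet> (X s - X t) - C / 2 * ((X s - X t) \<bullet> (X s - X t))" for s
  have Xd: "((\<lambda>s. X s - X t) has_derivative (\<lambda>h. h *\<^sub>R w)) (at t)"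
    using X unfolding has_vector_derivative_def by (auto intro!: derivative_eq_intros)
  have "(f has_derivative (\<lambda>h. h * d - p \<bullet> (h *\<^sub>R w))) (at t)"
    unfolding f_def
    by (rule derivative_eq_intros Xd uX[unfolded has_field_derivative_def] refl)+ auto
  then have fd: "(f has_real_derivative (d - p \<bullet> w)) (at t)"
    unfolding has_field_derivative_def by (rule has_derivative_eq_rhs) (auto simp: fun_eq_iff algebra_simps)
  obtain \<delta> where \<delta>: "\<delta> > 0" "\<And>s. dist s t < \<delta> \<Longrightarrow> X s \<in> ball (X t) r"
    using has_vector_derivative_continuous[OF X] r(1) unfolding continuous_at_eps_delta
    by (auto simp: dist_commute)
  have "f s \<le> f t" if "\<bar>t - s\<bar> < \<delta>" for s
    using superdiff_upper_bound[OF p r(2) \<delta>(2)[of s]] that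
    by (simp add: f_def dist_real_def abs_minus_commute dot_square_norm)
  then have "d - p \<bullet> w = 0"
    using DERIV_local_max[OF fd \<delta>(1)] by blast
  then show ?thesis by simp
qed

end

section \<open>Supergradients along singular arcs\<close>

text \<open>Rotation by a right angle. It keeps lengths, so constants are expressed through
  \<open>norm v\<close> without normalising, and it is linear, so normals converge along with
  velocities.\<close>

definition perp :: "real^2 \<Rightarrow> real^2" where
  "perp a = (\<chi> i. if i = 1 then - (a $ 2) else a $ 1)"

lemma perp_nth [simp]: "perp a $ 1 = - (a $ 2)" "perp a $ 2 = a $ 1"
  by (auto simp: perp_def)

lemma bounded_linear_perp: "bounded_linear perp"
  by (auto intro!: linear_conv_bounded_linear[THEN iffD1] linearI simp: vec_eq_iff forall_2)

lemma inner_perp [simp]: "a \<bullet> perp a = 0" "perp a \<bullet> a = 0"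
  by (auto simp: inner_vec_def sum_2)

lemma inner_perp_perp [simp]: "perp a \<bullet> perp b = a \<bullet> b"
  by (auto simp: inner_vec_def sum_2)

text \<open>Here the dimension enters: the orthogonal complement of a nonzero vector in the plane is
  a line.\<close>

lemma orthogonal_imp_multiple_perp:
  assumes "z \<bullet> a = 0" "a \<noteq> 0"
  obtains s where "z = s *\<^sub>R perp a"
proof (cases "a $ 1 = 0")
  case True
  then have "a $ 2 \<noteq> 0" using assms(2) by (auto simp: vec_eq_iff forall_2)
  then show ?thesis using that[of "- (z $ 1) / a $ 2"] True assms(1)
    by (auto simp: vec_eq_iff forall_2 inner_vec_def sum_2)
next
  case False
  then show ?thesis using that[of "z $ 2 / a $ 1"] assms(1)
    by (auto simp: vec_eq_iff forall_2 inner_vec_def sum_2 field_simps)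
qed

locale hamilton_jacobi_solution = semiconcave_function \<Omega> u C
  for \<Omega> :: "(real^2) set" and u :: "real^2 \<Rightarrow> real" and C :: real +
  fixes H :: "real^2 \<Rightarrow> real^2 \<Rightarrow> real"
  assumes H_continuous: "continuous_on (\<Omega> \<times> UNIV) (\<lambda>(x, p). H x p)"
    and H_convex: "\<And>x. x \<in> \<Omega> \<Longrightarrow> strictly_convex (H x)"
    and subsolution: "\<And>x p. x \<in> \<Omega> \<Longrightarrow> p \<in> superdiff \<Omega> u x \<Longrightarrow> H x p \<le> 0"
    and supersolution: "\<And>x p. x \<in> \<Omega> \<Longrightarrow> p \<in> subdiff \<Omega> u x \<Longrightarrow> H x p \<ge> 0"
begin

lemma H_tendsto:
  assumes "x \<in> \<Omega>" "X \<longlonglongrightarrow> x" "P \<longlonglongrightarrow> p" "\<And>k::nat. X k \<in> \<Omega>"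
  shows "(\<lambda>k. H (X k) (P k)) \<longlonglongrightarrow> H x p"
  using continuous_on_tendsto_compose[OF H_continuous, of "\<lambda>k. (X k, P k)" "(x, p)"] assms
  by (auto intro: tendsto_Pair)

text \<open>Approach in direction \<open>- m\<close>: the least inner product with
  \<open>- m\<close> is the greatest with \<open>m\<close>. The supersolution property holds at the
  sampled differentials, and continuity of \<open>H\<close> carries its sign to the limit.\<close>

lemma exists_nonneg_extremal_superdiff:
  assumes x: "x \<in> \<Omega>"
  obtains p where "p \<in> D x" "H x p \<ge> 0" "\<And>q. q \<in> D x \<Longrightarrow> q \<bullet> m \<le> p \<bullet> m"
proof -
  obtain Y P p where *: "\<And>k::nat. P k \<in> subdiff \<Omega> u (Y k)" "\<And>k. Y k \<in> \<Omega>" "Y \<longlonglongrightarrow> x" "P \<longlonglongrightarrow> p"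
    "p \<in> D x" "\<And>q. q \<in> D x \<Longrightarrow> p \<bullet> (- m) \<le> q \<bullet> (- m)"
    by (rule exists_limit_differential_minimising[OF x, of "- m"]) (assumption | rule that)+
  have "H x p \<ge> 0"
    by (rule LIMSEQ_le_const[OF H_tendsto[OF x *(3,4,2)]]) (use *(1,2) supersolution in blast)
  then show ?thesis using that *(5,6) by auto
qed

text \<open>If \<open>D x\<close> is a nondegenerate segment orthogonal to \<open>w\<close>, then \<open>H x\<close> is nonpositive on it and
  nonnegative at its endpoint, so by convexity it stays nonnegative beyond that endpoint.\<close>

lemma H_nonneg_beyond_endpoint:
  assumes x: "x \<in> Sing \<Omega> u" and "w \<noteq> 0" and flat: "\<And>p q. p \<in> D x \<Longrightarrow> q \<in> D x \<Longrightarrow> p \<bullet> w = q \<bullet> w"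
    and m: "m = perp w \<or> m = - perp w"
    and p: "p \<in> D x" "H x p \<ge> 0" "\<And>q. q \<in> D x \<Longrightarrow> q \<bullet> m \<le> p \<bullet> m" and "s \<ge> 0"
  shows "H x (p + s *\<^sub>R m) \<ge> 0"
proof (rule ccontr)
  assume neg: "\<not> ?thesis"
  then have "s > 0" using p(2) \<open>s \<ge> 0\<close> by (cases "s = 0") auto
  have x\<Omega>: "x \<in> \<Omega>" using x by (simp add: Sing_def)
  have "\<not> is_singleton (D x)" using x by (simp add: Sing_def)
  then have "D x \<noteq> {p}" by (auto simp: is_singleton_def)
  then obtain q where q: "q \<in> D x" "q \<noteq> p" using p(1) by blast
  have "(p - q) \<bullet> w = 0" using flat[OF p(1) q(1)] by (simp add: inner_diff_left)
  then obtain t' where t': "p - q = t' *\<^sub>R perp w" using \<open>w \<noteq> 0\<close> by (rule orthogonal_imp_multiple_perp)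
  obtain t where t: "p - q = t *\<^sub>R m" using m t' that[of t'] that[of "- t'"] by auto
  have "m \<bullet> m = w \<bullet> w" using m by auto
  then have mm: "m \<bullet> m > 0" using \<open>w \<noteq> 0\<close> by (metis inner_gt_zero_iff)
  have "t * (m \<bullet> m) \<ge> 0" using p(3)[OF q(1)] arg_cong[OF t, of "\<lambda>z. z \<bullet> m"] by (simp add: inner_diff_left)
  then have "t \<ge> 0" using mm by (simp add: zero_le_mult_iff)
  moreover have "t \<noteq> 0" using t q(2) by auto
  ultimately have "t > 0" by simp
  \<comment> \<open>The weight that makes \<open>p\<close> the convex combination of
    \<open>p + s *\<^sub>R m\<close> and \<open>q = p - t *\<^sub>R m\<close>.\<close>
  define l where "l = t / (s + t)"
  have l: "0 < l" "l < 1" using \<open>t > 0\<close> \<open>s > 0\<close> by (auto simp: l_def)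
  have "l * s = (1 - l) * t" using \<open>t > 0\<close> \<open>s > 0\<close> by (simp add: l_def field_simps)
  moreover have q_eq: "q = p - t *\<^sub>R m" using t by (simp add: algebra_simps)
  have "l *\<^sub>R (p + s *\<^sub>R m) + (1 - l) *\<^sub>R q = p + (l * s - (1 - l) * t) *\<^sub>R m"
    unfolding q_eq by (simp add: algebra_simps)
  ultimately have eq: "l *\<^sub>R (p + s *\<^sub>R m) + (1 - l) *\<^sub>R q = p" by simp
  have "p + s *\<^sub>R m \<noteq> q"
  proof
    assume "p + s *\<^sub>R m = q"
    then have "(t + s) *\<^sub>R m = 0" using t by (auto simp: algebra_simps)
    then show False using \<open>t > 0\<close> \<open>s > 0\<close> mm by auto
  qed
  then have "H x p < l * H x (p + s *\<^sub>R m) + (1 - l) * H x q"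
    using H_convex[OF x\<Omega>] l eq unfolding strictly_convex_def by metis
  moreover have "H x q \<le> 0" using subsolution x\<Omega> q by blast
  then have "(1 - l) * H x q \<le> 0" using l by (simp add: mult_nonneg_nonpos)
  moreover have "l * H x (p + s *\<^sub>R m) < 0" using neg l by (simp add: mult_pos_neg)
  ultimately show False using p(2) by simp
qed

text \<open>If the claim fails, the extremal supergradients \<open>P k\<close> accumulate at some
  \<open>pb = p0 + s *\<^sub>R m0\<close> with \<open>s \<le> c\<close>. Then
  \<open>p0 + c *\<^sub>R m0\<close> is a limit of points beyond the endpoints, so
  \<open>H x0\<close> is nonnegative there, against \<open>neg\<close>.\<close>

lemma exists_superdiff_beyond:
  assumes x0: "x0 \<in> \<Omega>" and p0: "p0 \<in> D x0" and "v \<noteq> 0" and min: "\<And>q. q \<in> D x0 \<Longrightarrow> p0 \<bullet> v \<le> q \<bullet> v"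
    and \<sigma>: "\<sigma> = 1 \<or> \<sigma> = -1" and neg: "H x0 (p0 + c *\<^sub>R (\<sigma> *\<^sub>R perp v)) < 0"
    and \<tau>: "\<And>k::nat. \<tau> k > 0" "\<tau> \<longlonglongrightarrow> 0" and \<theta>: "\<theta> \<longlonglongrightarrow> v" and w: "w \<longlonglongrightarrow> v" "\<And>k. w k \<noteq> 0"
    and sing: "\<And>k. x0 + \<tau> k *\<^sub>R \<theta> k \<in> Sing \<Omega> u"
    and flat: "\<And>k p q. p \<in> D (x0 + \<tau> k *\<^sub>R \<theta> k) \<Longrightarrow> q \<in> D (x0 + \<tau> k *\<^sub>R \<theta> k) \<Longrightarrow> p \<bullet> w k = q \<bullet> w k"
  shows "\<exists>k. \<exists>p\<in>D (x0 + \<tau> k *\<^sub>R \<theta> k). c * (v \<bullet> v) \<le> (p - p0) \<bullet> (\<sigma> *\<^sub>R perp v)"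
proof (rule ccontr)
  assume "\<not> ?thesis"
  then have small: "\<And>k p. p \<in> D (x0 + \<tau> k *\<^sub>R \<theta> k) \<Longrightarrow> (p - p0) \<bullet> (\<sigma> *\<^sub>R perp v) < c * (v \<bullet> v)"
    by (meson not_le)
  define x where "x k = x0 + \<tau> k *\<^sub>R \<theta> k" for k
  \<comment> \<open>The normal follows the actual velocity \<open>w k\<close>: the superdifferential
    at \<open>x k\<close> is orthogonal to \<open>w k\<close>, and to \<open>v\<close> only in the
    limit.\<close>
  define m where "m k = \<sigma> *\<^sub>R perp (w k)" for k
  define m0 where "m0 = \<sigma> *\<^sub>R perp v"
  have mm: "m0 \<bullet> m0 = v \<bullet> v" using \<sigma> by (auto simp: m0_def)
  have xlim: "x \<longlonglongrightarrow> x0"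
  proof -
    have "x \<longlonglongrightarrow> x0 + 0 *\<^sub>R v" unfolding x_def by (intro tendsto_intros \<tau> \<theta>)
    then show ?thesis by simp
  qed
  have mlim: "m \<longlonglongrightarrow> m0"
    unfolding m_def m0_def by (intro tendsto_intros bounded_linear.tendsto[OF bounded_linear_perp] w)
  have x\<Omega>: "x k \<in> \<Omega>" for k using sing[of k] by (simp add: x_def Sing_def)
  have "\<forall>k. \<exists>p. p \<in> D (x k) \<and> H (x k) p \<ge> 0 \<and> (\<forall>q\<in>D (x k). q \<bullet> m k \<le> p \<bullet> m k)"
  proof
    fix k
    show "\<exists>p. p \<in> D (x k) \<and> H (x k) p \<ge> 0 \<and> (\<forall>q\<in>D (x k). q \<bullet> m k \<le> p \<bullet> m k)"
      by (rule exists_nonneg_extremal_superdiff[OF x\<Omega>, of k "m k"]) blast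
  qed
  from choice[OF this] obtain P where
    "\<forall>k. P k \<in> D (x k) \<and> H (x k) (P k) \<ge> 0 \<and> (\<forall>q\<in>D (x k). q \<bullet> m k \<le> P k \<bullet> m k)" ..
  then have P: "\<And>k. P k \<in> D (x k)" "\<And>k. H (x k) (P k) \<ge> 0"
    "\<And>k q. q \<in> D (x k) \<Longrightarrow> q \<bullet> m k \<le> P k \<bullet> m k"
    by simp_all
  have beyond: "H (x k) (P k + s *\<^sub>R m k) \<ge> 0" if "s \<ge> 0" for k s
  proof (rule H_nonneg_beyond_endpoint[OF _ w(2) _ _ P(1,2) _ that])
    show "x k \<in> Sing \<Omega> u" using sing[of k] by (simp add: x_def)
    show "p \<bullet> w k = q \<bullet> w k" if "p \<in> D (x k)" "q \<in> D (x k)" for p q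
      using flat that unfolding x_def by blast
    show "m k = perp (w k) \<or> m k = - perp (w k)" using \<sigma> by (auto simp: m_def)
    show "q \<bullet> m k \<le> P k \<bullet> m k" if "q \<in> D (x k)" for q using P(3) that .
  qed
  obtain r M where r: "r > 0" and M: "\<And>y p. y \<in> ball x0 r \<Longrightarrow> p \<in> D y \<Longrightarrow> norm p \<le> M"
    using superdiff_bounded_near[OF x0] by metis
  obtain n where n: "\<And>k. k \<ge> n \<Longrightarrow> x k \<in> ball x0 r"
    using tendstoD[OF xlim r] by (auto simp: eventually_sequentially dist_commute)
  have "\<forall>k. P (k + n) \<in> cball 0 M" using M[OF n P(1)] by simp
  then obtain pb \<phi> where \<phi>: "strict_mono (\<phi> :: nat \<Rightarrow> nat)" "((\<lambda>k. P (k + n)) \<circ> \<phi>) \<longlonglongrightarrow> pb"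
    using compact_imp_seq_compact[OF compact_cball[of "0::real^2" M]] unfolding seq_compact_def by metis
  define \<psi> where "\<psi> k = \<phi> k + n" for k
  have \<psi>: "strict_mono \<psi>" using \<phi>(1) by (auto simp: \<psi>_def strict_mono_def)
  have Plim: "(\<lambda>k. P (\<psi> k)) \<longlonglongrightarrow> pb" using \<phi>(2) by (simp add: o_def \<psi>_def)
  have lims: "(\<lambda>k. \<tau> (\<psi> k)) \<longlonglongrightarrow> 0" "(\<lambda>k. \<theta> (\<psi> k)) \<longlonglongrightarrow> v" "(\<lambda>k. m (\<psi> k)) \<longlonglongrightarrow> m0" "(\<lambda>k. x (\<psi> k)) \<longlonglongrightarrow> x0"
    using LIMSEQ_subseq_LIMSEQ[OF \<tau>(2) \<psi>] LIMSEQ_subseq_LIMSEQ[OF \<theta> \<psi>]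
      LIMSEQ_subseq_LIMSEQ[OF mlim \<psi>] LIMSEQ_subseq_LIMSEQ[OF xlim \<psi>] by (auto simp: o_def)
  have P': "P (\<psi> k) \<in> D (x0 + \<tau> (\<psi> k) *\<^sub>R \<theta> (\<psi> k))" for k using P(1)[of "\<psi> k"] by (simp add: x_def)
  note face = superdiff_limit_in_face[OF x0 \<tau>(1) lims(1,2) P' Plim]
  \<comment> \<open>Both \<open>pb\<close> and \<open>p0\<close> lie in the face of
    \<open>D x0\<close> exposed by \<open>v\<close>.\<close>
  have "pb \<bullet> v = p0 \<bullet> v" using face(2)[OF p0] min[OF face(1)] by simp
  then have "(pb - p0) \<bullet> v = 0" by (simp add: inner_diff_left)
  then obtain s' where s': "pb - p0 = s' *\<^sub>R perp v" using \<open>v \<noteq> 0\<close> by (rule orthogonal_imp_multiple_perp)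
  define s where "s = \<sigma> * s'"
  have s: "pb - p0 = s *\<^sub>R m0" using s' \<sigma> by (auto simp: s_def m0_def)
  have "(pb - p0) \<bullet> m0 \<le> c * (v \<bullet> v)"
  proof (rule LIMSEQ_le_const2)
    show "(\<lambda>k. (P (\<psi> k) - p0) \<bullet> m0) \<longlonglongrightarrow> (pb - p0) \<bullet> m0" by (intro tendsto_intros Plim)
    show "\<exists>N. \<forall>k\<ge>N. (P (\<psi> k) - p0) \<bullet> m0 \<le> c * (v \<bullet> v)"
      using small[OF P'] unfolding m0_def by (blast intro: less_imp_le)
  qed
  then have "s * (v \<bullet> v) \<le> c * (v \<bullet> v)" by (simp add: s mm)
  then have "s \<le> c" using \<open>v \<noteq> 0\<close> by simp
  have "H x0 (pb + (c - s) *\<^sub>R m0) \<ge> 0"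
  proof (rule LIMSEQ_le_const)
    show "(\<lambda>k. H (x (\<psi> k)) (P (\<psi> k) + (c - s) *\<^sub>R m (\<psi> k))) \<longlonglongrightarrow> H x0 (pb + (c - s) *\<^sub>R m0)"
      by (intro H_tendsto x0 x\<Omega> lims tendsto_intros Plim)
    show "\<exists>N. \<forall>k\<ge>N. 0 \<le> H (x (\<psi> k)) (P (\<psi> k) + (c - s) *\<^sub>R m (\<psi> k))"
      using beyond \<open>s \<le> c\<close> by simp
  qed
  moreover have "pb + (c - s) *\<^sub>R m0 = p0 + c *\<^sub>R m0" using s by (simp add: algebra_simps)
  ultimately show False using neg by (simp add: m0_def)
qed

text \<open>Otherwise bad times occur arbitrarily near 0. Each is traded for a bad time at which the
  arc and \<open>u\<close> along it are differentiable, so that all supergradients there agree along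
  the velocity; a sequence of such times contradicts \<open>exists_superdiff_beyond\<close>.\<close>

lemma arc_superdiff_beyond:
  assumes x0: "x0 \<in> \<Omega>" and p0: "p0 \<in> D x0" and "v \<noteq> 0" and min: "\<And>q. q \<in> D x0 \<Longrightarrow> p0 \<bullet> v \<le> q \<bullet> v"
    and \<sigma>: "\<sigma> = 1 \<or> \<sigma> = -1" and neg: "H x0 (p0 + c *\<^sub>R (\<sigma> *\<^sub>R perp v)) < 0"
    and "T > 0" and X: "X \<in> Lip0_sing u T \<Omega>" and X0: "X 0 = x0" and vd: "(X has_vector_derivative v) (at_right 0)"
  obtains d where "0 < d" "d \<le> T"
    "\<And>t. 0 < t \<Longrightarrow> t < d \<Longrightarrow> \<exists>p\<in>D (X t). c * (v \<bullet> v) \<le> (p - p0) \<bullet> (\<sigma> *\<^sub>R perp v)"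
proof (rule ccontr)
  note result = that
  assume "\<not> thesis"
  define m where "m = \<sigma> *\<^sub>R perp v"
  define a where "a = c * (v \<bullet> v) + p0 \<bullet> m"
  have a_iff: "c * (v \<bullet> v) \<le> (p - p0) \<bullet> (\<sigma> *\<^sub>R perp v) \<longleftrightarrow> a \<le> p \<bullet> m" for p
    by (auto simp: a_def m_def inner_diff_left right_diff_distrib)
  have bad: "\<exists>t. 0 < t \<and> t < d \<and> (\<forall>p\<in>D (X t). \<not> a \<le> p \<bullet> m)" if "0 < d" "d \<le> T" for d
  proof (rule ccontr)
    assume "\<not> ?thesis"
    then have "thesis" unfolding a_iff[symmetric] by (intro result[OF that]) blast
    with \<open>\<not> thesis\<close> show False ..
  qed
  have XL: "X \<in> Lip0 T \<Omega>" and sing: "\<And>t. 0 \<le> t \<Longrightarrow> t \<le> T \<Longrightarrow> X t \<in> Sing \<Omega> u"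
    using X by (auto simp: Lip0_sing_def)
  obtain L where L: "L-lipschitz_on {0..T} X" using XL by (auto simp: Lip0_def)
  have Xcont: "continuous_on {0..T} X" using L by (rule lipschitz_on_continuous_on)
  obtain r K where r: "r > 0" "ball x0 r \<subseteq> \<Omega>" "K-lipschitz_on (ball x0 r) u" by (rule lipschitz_near[OF x0])
  obtain e where e: "e > 0" "\<And>t. t \<in> {0..T} \<Longrightarrow> dist t 0 < e \<Longrightarrow> dist (X t) (X 0) < r"
    using Xcont r(1) \<open>T > 0\<close> unfolding continuous_on_iff by (metis atLeastAtMost_iff less_eq_real_def)
  \<comment> \<open>Up to \<open>d0\<close> the arc stays where \<open>u\<close> is Lipschitz, so
    \<open>u\<close> along the arc is differentiable almost everywhere.\<close>
  define d0 where "d0 = min T (e / 2)"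
  have d0: "0 < d0" "d0 \<le> T" using e \<open>T > 0\<close> by (auto simp: d0_def)
  have inball: "X t \<in> ball x0 r" if "t \<in> {0..d0}" for t
    using e(2)[of t] that e(1) d0 X0 by (auto simp: d0_def dist_commute)
  have XL0: "L-lipschitz_on {0..d0} X" using L by (rule lipschitz_on_subset) (use d0 in auto)
  have uK: "K-lipschitz_on (X ` {0..d0}) u" using r(3) by (rule lipschitz_on_subset) (use inball in auto)
  from lipschitz_on_compose2[OF XL0 uK] have "(K * L)-lipschitz_on {0..d0} (\<lambda>t. u (X t))" by (simp add: mult.commute)
  then have N0: "negligible {t \<in> {0..d0}. \<not> (\<lambda>t. u (X t)) differentiable (at t within {0..d0})}" (is "negligible ?N0")
    by (rule lipschitz_differentiable_ae)
  \<comment> \<open>With \<open>k + 2\<close> the tolerance is at most half of \<open>norm v\<close>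
    already for \<open>k = 0\<close>, hence \<open>w\<close> is never zero.\<close>
  define good where "good k tw \<longleftrightarrow> (case tw of (t, w) \<Rightarrow> 0 < t \<and> t < 1 / real (Suc k) \<and> t < T \<and> norm (w - v) \<le> norm v / real (k + 2) \<and>
      (\<forall>p\<in>D (X t). \<not> a \<le> p \<bullet> m) \<and> (\<forall>p\<in>D (X t). \<forall>q\<in>D (X t). p \<bullet> w = q \<bullet> w))" for k tw
  have "\<forall>k. \<exists>tw. good k tw"
  proof
    fix k
    have "norm v / real (k + 2) > 0" using \<open>v \<noteq> 0\<close> by simp
    from Lip0_derivative_near[OF XL \<open>T > 0\<close> vd this] obtain d1 N1 where d1: "0 < d1" "d1 \<le> T" "negligible N1"
      and der: "\<And>t. 0 < t \<Longrightarrow> t < d1 \<Longrightarrow> t \<notin> N1 \<Longrightarrow> \<exists>w. (X has_vector_derivative w) (at t) \<and> norm (w - v) \<le> norm v / real (k + 2)"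
      by blast
    define d where "d = min (min d0 d1) (1 / real (Suc k))"
    have d: "0 < d" "d \<le> T" "d \<le> d0" "d \<le> d1" "d \<le> 1 / real (Suc k)" using d0 d1 by (auto simp: d_def)
    obtain t where t: "0 < t" "t < d" "\<forall>p\<in>D (X t). \<not> a \<le> p \<bullet> m" using bad d by blast
    \<comment> \<open>The bad time \<open>t\<close> need not be a time of differentiability. If all
      such times in the interval had a supergradient in the half-space, letting them tend to
      \<open>t\<close> would produce one at \<open>t\<close>.\<close>
    have "\<exists>t'. t' \<in> {0<..<d} - (?N0 \<union> N1) \<and> (\<forall>p\<in>D (X t'). \<not> a \<le> p \<bullet> m)"
    proof (rule ccontr)
      assume "\<not> ?thesis"
      then have near: "\<exists>p\<in>D (X t'). a \<le> p \<bullet> m" if "t' \<in> {0<..<d}" "t' \<notin> ?N0 \<union> N1" for t'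
        using that by blast
      have "\<forall>j. \<exists>t'. t' \<in> {0<..<d} \<and> t' \<notin> ?N0 \<union> N1 \<and> \<bar>t' - t\<bar> < 1 / real (Suc j)"
      proof
        fix j
        define b where "b = min d (t + 1 / real (Suc j))"
        have "t < b" using t by (simp add: b_def)
        then have "\<not> negligible {t<..<b}"
          by (auto simp: negligible_iff_null_sets null_sets_def)
        then have "\<not> {t<..<b} \<subseteq> ?N0 \<union> N1"
          using negligible_subset[OF negligible_Un[OF N0 d1(3)]] by blast
        then obtain t' where "t' \<in> {t<..<b}" "t' \<notin> ?N0 \<union> N1" by blast
        then show "\<exists>t'. t' \<in> {0<..<d} \<and> t' \<notin> ?N0 \<union> N1 \<and> \<bar>t' - t\<bar> < 1 / real (Suc j)"
          using t by (intro exI[of _ t']) (auto simp: b_def)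
      qed
      from choice[OF this] obtain \<xi> where
        "\<forall>j. \<xi> j \<in> {0<..<d} \<and> \<xi> j \<notin> ?N0 \<union> N1 \<and> \<bar>\<xi> j - t\<bar> < 1 / real (Suc j)" ..
      then have \<xi>: "\<And>j. \<xi> j \<in> {0<..<d}" "\<And>j. \<xi> j \<notin> ?N0 \<union> N1" "\<And>j. \<bar>\<xi> j - t\<bar> < 1 / real (Suc j)"
        by blast+
      have "(\<lambda>j. \<xi> j - t) \<longlonglongrightarrow> 0"
        by (rule Lim_null_comparison[OF _ LIMSEQ_inverse_real_of_nat])
          (use \<xi>(3) in \<open>auto simp: divide_inverse less_imp_le\<close>)
      then have \<xi>lim: "\<xi> \<longlonglongrightarrow> t" by (simp add: LIM_zero_iff)
      have \<xi>T: "\<xi> j \<in> {0..T}" for j using \<xi>(1)[of j] d by auto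
      have Xlim: "(\<lambda>j. X (\<xi> j)) \<longlonglongrightarrow> X t"
        by (rule continuous_on_tendsto_compose[OF Xcont \<xi>lim]) (use t d \<xi>T in auto)
      have Xt: "X t \<in> \<Omega>" using sing[of t] t d by (auto simp: Sing_def)
      have "\<exists>p\<in>D (X (\<xi> j)). a \<le> p \<bullet> m" for j using near \<xi>(1,2) by blast
      from superdiff_halfspace_limit[OF Xt Xlim this] have "\<exists>p\<in>D (X t). a \<le> p \<bullet> m" .
      then show False using t(3) by blast
    qed
    then obtain t' where t': "0 < t'" "t' < d" "t' \<notin> ?N0" "t' \<notin> N1" "\<forall>p\<in>D (X t'). \<not> a \<le> p \<bullet> m" by auto
    obtain w where w: "(X has_vector_derivative w) (at t')" "norm (w - v) \<le> norm v / real (k + 2)"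
      using der[of t'] t' d by auto
    have "(\<lambda>t. u (X t)) differentiable (at t' within {0..d0})" using t' d by auto
    moreover have "at t' within {0..d0} = at t'" using t' d by (intro at_within_interior) auto
    ultimately obtain D' where "((\<lambda>t. u (X t)) has_real_derivative D') (at t')"
      unfolding real_differentiable_def by metis
    moreover have "X t' \<in> \<Omega>" using sing[of t'] t' d by (auto simp: Sing_def)
    ultimately have "\<forall>p\<in>D (X t'). p \<bullet> w = D'" using superdiff_inner_velocity[OF _ w(1)] by simp
    then have "good k (t', w)" using t' d w(2) by (auto simp: good_def)
    then show "\<exists>tw. good k tw" ..
  qed
  from choice[OF this] obtain tw where tw: "\<forall>k. good k (tw k)" ..
  define t where "t k = fst (tw k)" for k
  define w where "w k = snd (tw k)" for k
  have good: "good k (t k, w k)" for k using tw by (simp add: t_def w_def)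
  then have t: "0 < t k" "t k < 1 / real (Suc k)" "t k < T" and w: "norm (w k - v) \<le> norm v / real (k + 2)" for k
    unfolding good_def by simp_all
  have tbad: "\<not> a \<le> p \<bullet> m" if "p \<in> D (X (t k))" for k p using good[of k] that unfolding good_def by simp
  have flat: "p \<bullet> w k = q \<bullet> w k" if "p \<in> D (X (t k))" "q \<in> D (X (t k))" for k p q
    using good[of k] that unfolding good_def by blast
  have tlim: "t \<longlonglongrightarrow> 0"
    by (rule Lim_null_comparison[OF _ LIMSEQ_inverse_real_of_nat])
      (use t in \<open>auto simp: divide_inverse less_imp_le abs_of_pos\<close>)
  \<comment> \<open>Secant directions; the right derivative of \<open>X\<close> at 0 sends them to
    \<open>v\<close>.\<close>
  define \<theta> where "\<theta> k = (1 / t k) *\<^sub>R (X (t k) - x0)" for k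
  have Xt: "X (t k) = x0 + t k *\<^sub>R \<theta> k" for k using t(1)[of k] by (simp add: \<theta>_def)
  have \<theta>lim: "\<theta> \<longlonglongrightarrow> v"
  proof -
    have "((\<lambda>s. (1 / norm (s - 0)) *\<^sub>R (X s - (X 0 + (s - 0) *\<^sub>R v))) \<longlongrightarrow> 0) (at_right 0)"
      using vd unfolding has_vector_derivative_def has_derivative_within by blast
    moreover have "filterlim t (at_right 0) sequentially"
      unfolding filterlim_at using t(1) tlim by (auto intro!: always_eventually simp: less_imp_neq[symmetric])
    ultimately have "(\<lambda>k. (1 / norm (t k - 0)) *\<^sub>R (X (t k) - (X 0 + (t k - 0) *\<^sub>R v))) \<longlonglongrightarrow> 0"
      by (rule filterlim_compose)
    moreover have "(1 / norm (t k - 0)) *\<^sub>R (X (t k) - (X 0 + (t k - 0) *\<^sub>R v)) = \<theta> k - v" for k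
      using t(1)[of k] by (simp add: \<theta>_def X0 algebra_simps)
    ultimately show ?thesis by (simp add: LIM_zero_iff)
  qed
  have wlim: "w \<longlonglongrightarrow> v"
  proof -
    have "(\<lambda>k. norm v / real (k + 2)) \<longlonglongrightarrow> 0"
      using LIMSEQ_ignore_initial_segment[OF lim_const_over_n, of "norm v" 2] by simp
    then have "(\<lambda>k. w k - v) \<longlonglongrightarrow> 0"
      by (rule Lim_null_comparison[rotated]) (use w in auto)
    then show ?thesis by (simp add: LIM_zero_iff)
  qed
  have w0: "w k \<noteq> 0" for k
  proof
    assume "w k = 0"
    then have "norm v \<le> norm v / real (k + 2)" using w[of k] by simp
    then show False using \<open>v \<noteq> 0\<close> by (simp add: le_divide_eq)
  qed
  have tsing: "x0 + t k *\<^sub>R \<theta> k \<in> Sing \<Omega> u" for k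
    using sing[of "t k"] t[of k] by (simp add: Xt[symmetric])
  have tflat: "p \<bullet> w k = q \<bullet> w k" if "p \<in> D (x0 + t k *\<^sub>R \<theta> k)" "q \<in> D (x0 + t k *\<^sub>R \<theta> k)" for k p q
    using flat that unfolding Xt .
  have "\<exists>k. \<exists>p\<in>D (x0 + t k *\<^sub>R \<theta> k). c * (v \<bullet> v) \<le> (p - p0) \<bullet> (\<sigma> *\<^sub>R perp v)"
    by (rule exists_superdiff_beyond[OF x0 p0 \<open>v \<noteq> 0\<close> min \<sigma> neg t(1) tlim \<theta>lim wlim w0 tsing tflat])
  then show False unfolding a_iff Xt[symmetric] using tbad by blast
qed

text \<open>\<open>p0\<close> cancels in \<open>p - q\<close>, so the two opposite excesses add up,
  and monotonicity compares a term linear in \<open>h\<close> with one quadratic in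
  \<open>h\<close>.\<close>

lemma no_transversal_gap:
  assumes ball: "ball x0 (3 * r) \<subseteq> \<Omega>" and xy: "x \<in> ball x0 r" "y \<in> ball x0 r"
    and p: "p \<in> D x" "c * (m \<bullet> m) \<le> (p - p0) \<bullet> m" and q: "q \<in> D y" "c * (m \<bullet> m) \<le> (q - p0) \<bullet> (- m)"
    and "m \<noteq> 0" and eq: "x - y = h *\<^sub>R m" and h: "h > 0"
  shows "2 * c \<le> C * h"
proof -
  have "(p - q) \<bullet> (x - y) \<le> C * (norm (x - y))\<^sup>2" by (rule superdiff_monotone[OF ball xy p(1) q(1)])
  moreover have "(p - q) \<bullet> (x - y) = h * ((p - p0) \<bullet> m + (q - p0) \<bullet> (- m))"
    by (simp add: eq inner_diff_left)
  moreover have "h * (2 * c * (m \<bullet> m)) \<le> h * ((p - p0) \<bullet> m + (q - p0) \<bullet> (- m))"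
    using p(2) q(2) h by (intro mult_left_mono) auto
  moreover have "(norm (x - y))\<^sup>2 = h * h * (m \<bullet> m)" 
    unfolding power2_norm_eq_inner eq by simp
  ultimately have "(h * (m \<bullet> m)) * (2 * c) \<le> (h * (m \<bullet> m)) * (C * h)" by (simp add: mult_ac)
  moreover have "h * (m \<bullet> m) > 0" using h \<open>m \<noteq> 0\<close> by simp
  ultimately show ?thesis by (simp only: mult_le_cancel_left_pos)
qed

end

section \<open>Reparametrisation\<close>

text \<open>\<open>g\<close> is a height at which both curves climb with speed between \<kappa> and
  \<open>K\<close>. Matching heights compares the two clocks, so \<phi> and its inverse have
  Lipschitz constant \<open>K / \<kappa>\<close>.\<close>

lemma unique_bilipschitz_reparametrisation:
  fixes X\<^sub>1 X\<^sub>2 :: "real \<Rightarrow> 'a" and g :: "'a \<Rightarrow> real"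
  assumes d: "0 < d" "d \<le> T" and \<kappa>: "0 < \<kappa>"
    and low1: "\<And>s t. 0 \<le> s \<Longrightarrow> s \<le> t \<Longrightarrow> t \<le> d \<Longrightarrow> \<kappa> * (t - s) \<le> g (X\<^sub>1 t) - g (X\<^sub>1 s)"
    and up1: "\<And>s t. 0 \<le> s \<Longrightarrow> s \<le> t \<Longrightarrow> t \<le> d \<Longrightarrow> g (X\<^sub>1 t) - g (X\<^sub>1 s) \<le> K * (t - s)"
    and low2: "\<And>s t. 0 \<le> s \<Longrightarrow> s \<le> t \<Longrightarrow> t \<le> d \<Longrightarrow> \<kappa> * (t - s) \<le> g (X\<^sub>2 t) - g (X\<^sub>2 s)"
    and up2: "\<And>s t. 0 \<le> s \<Longrightarrow> s \<le> t \<Longrightarrow> t \<le> d \<Longrightarrow> g (X\<^sub>2 t) - g (X\<^sub>2 s) \<le> K * (t - s)"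
    and start: "g (X\<^sub>1 0) = g (X\<^sub>2 0)"
    and cross: "\<And>s t. s \<in> {0..d} \<Longrightarrow> t \<in> {0..d} \<Longrightarrow> g (X\<^sub>1 s) = g (X\<^sub>2 t) \<Longrightarrow> X\<^sub>1 s = X\<^sub>2 t"
  shows "\<exists>\<sigma>\<in>{0<..T}. \<exists>!\<phi>. \<phi> \<in> extensional {0..\<sigma>} \<and> {0..\<phi> \<sigma>} \<subseteq> {0..T} \<and>
           bilipschitz_homeomorphism {0..\<sigma>} {0..\<phi> \<sigma>} \<phi> \<and> (\<forall>s\<in>{0..\<sigma>}. X\<^sub>1 s = X\<^sub>2 (\<phi> s))"
proof -
  have "\<kappa> * (d - 0) \<le> K * (d - 0)" by (rule order_trans[OF low1 up1]) (use d in auto)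
  then have \<kappa>K: "\<kappa> \<le> K" using d by simp
  then have K: "K > 0" using \<kappa> by simp
  \<comment> \<open>Until \<sigma> the first curve climbs at most \<open>\<kappa> * d / 2\<close>,
    strictly less than the second has climbed by time \<open>d\<close>. This gives existence by the
    intermediate value theorem and also keeps competitors of \<phi> below \<open>d\<close>.\<close>
  define \<sigma> where "\<sigma> = \<kappa> * d / (2 * K)"
  have \<sigma>: "0 < \<sigma>" "\<sigma> \<le> d / 2" using d \<kappa> K \<kappa>K by (auto simp: \<sigma>_def field_simps)
  have K\<sigma>: "K * \<sigma> = \<kappa> * d / 2" using K by (simp add: \<sigma>_def)
  have inj2: "s = t" if "s \<in> {0..d}" "t \<in> {0..d}" "g (X\<^sub>2 s) = g (X\<^sub>2 t)" for s t
  proof -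
    have "\<not> s < t" "\<not> t < s"
      using low2[of s t] low2[of t s] that mult_pos_pos[OF \<kappa>, of "t - s"] mult_pos_pos[OF \<kappa>, of "s - t"] by auto
    then show ?thesis by simp
  qed
  have below: "g (X\<^sub>1 s) < g (X\<^sub>2 d)" if "s \<in> {0..\<sigma>}" for s
  proof -
    have "g (X\<^sub>1 s) \<le> g (X\<^sub>1 0) + K * s" using up1[of 0 s] that \<sigma> d by auto
    also have "K * s \<le> \<kappa> * d / 2" unfolding K\<sigma>[symmetric] using K that by (intro mult_left_mono) auto
    also have "g (X\<^sub>1 0) + \<kappa> * d / 2 < g (X\<^sub>2 0) + \<kappa> * d" using start \<kappa> d by simp
    also have "\<dots> \<le> g (X\<^sub>2 d)" using low2[of 0 d] d by simp
    finally show ?thesis by simp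
  qed
  have nonneg: "0 \<le> \<kappa> * (t - s)" if "s \<le> t" for s t using that \<kappa> by simp
  have cont2: "continuous_on {0..d} (\<lambda>t. g (X\<^sub>2 t))"
  proof (rule lipschitz_on_continuous_on)
    show "K-lipschitz_on {0..d} (\<lambda>t. g (X\<^sub>2 t))"
    proof (rule lipschitz_on_leI)
      fix s t assume "s \<in> {0..d}" "t \<in> {0..d}" "s \<le> t"
      then have "g (X\<^sub>2 t) - g (X\<^sub>2 s) \<le> K * (t - s)" "g (X\<^sub>2 s) \<le> g (X\<^sub>2 t)" "s \<le> t"
        using up2[of s t] order_trans[OF nonneg low2[of s t]] by auto
      then show "dist (g (X\<^sub>2 s)) (g (X\<^sub>2 t)) \<le> K * dist s t" by (simp add: dist_real_def)
    qed (use K in simp)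
  qed
  have "\<exists>t. t \<in> {0..d} \<and> g (X\<^sub>2 t) = g (X\<^sub>1 s)" if s: "s \<in> {0..\<sigma>}" for s
  proof -
    have "g (X\<^sub>2 0) \<le> g (X\<^sub>1 s)"
      using order_trans[OF nonneg low1[of 0 s]] start s \<sigma> d by auto
    then show ?thesis
      using IVT'[of "\<lambda>t. g (X\<^sub>2 t)" 0 "g (X\<^sub>1 s)" d] below[OF s] cont2 d by (auto simp: less_imp_le)
  qed
  then obtain \<psi> where \<psi>: "\<And>s. s \<in> {0..\<sigma>} \<Longrightarrow> \<psi> s \<in> {0..d}" "\<And>s. s \<in> {0..\<sigma>} \<Longrightarrow> g (X\<^sub>2 (\<psi> s)) = g (X\<^sub>1 s)"
    by metis
  \<comment> \<open>Values outside the interval are normalised, so that uniqueness of the total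
    function means uniqueness on \<open>{0..\<sigma>}\<close>.\<close>
  define \<phi> where "\<phi> = restrict \<psi> {0..\<sigma>}"
  have \<phi>: "\<phi> s \<in> {0..d}" "g (X\<^sub>2 (\<phi> s)) = g (X\<^sub>1 s)" if "s \<in> {0..\<sigma>}" for s
    using \<psi> that by (auto simp: \<phi>_def)
  have incr: "\<phi> s \<le> \<phi> t \<and> \<kappa> * (t - s) \<le> K * (\<phi> t - \<phi> s) \<and> \<kappa> * (\<phi> t - \<phi> s) \<le> K * (t - s)"
    if st: "s \<in> {0..\<sigma>}" "t \<in> {0..\<sigma>}" "s \<le> t" for s t
  proof -
    have 1: "\<kappa> * (t - s) \<le> g (X\<^sub>1 t) - g (X\<^sub>1 s)" "g (X\<^sub>1 t) - g (X\<^sub>1 s) \<le> K * (t - s)"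
      using low1[of s t] up1[of s t] st \<sigma> d by auto
    have le: "\<phi> s \<le> \<phi> t"
    proof (rule ccontr)
      assume gt: "\<not> \<phi> s \<le> \<phi> t"
      then have "\<kappa> * (\<phi> s - \<phi> t) \<le> g (X\<^sub>1 s) - g (X\<^sub>1 t)" using low2[of "\<phi> t" "\<phi> s"] \<phi>[OF st(1)] \<phi>[OF st(2)] by auto
      moreover have "\<kappa> * (\<phi> s - \<phi> t) > 0" using gt \<kappa> by simp
      moreover have "\<kappa> * (t - s) \<ge> 0" using \<kappa> st by simp
      ultimately show False using 1 by linarith
    qed
    then show ?thesis using 1 low2[of "\<phi> s" "\<phi> t"] up2[of "\<phi> s" "\<phi> t"] \<phi>[OF st(1)] \<phi>[OF st(2)] by auto
  qed
  have lip: "(K / \<kappa>)-lipschitz_on {0..\<sigma>} \<phi>"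
  proof (rule lipschitz_on_leI)
    fix s t assume st: "s \<in> {0..\<sigma>}" "t \<in> {0..\<sigma>}" "s \<le> t"
    then show "dist (\<phi> s) (\<phi> t) \<le> K / \<kappa> * dist s t"
      using incr[OF st] \<kappa> by (auto simp: dist_real_def field_simps)
  qed (use K \<kappa> in simp)
  then have cont: "continuous_on {0..\<sigma>} \<phi>" by (rule lipschitz_on_continuous_on)
  have inv_le: "dist s t \<le> K / \<kappa> * dist (\<phi> s) (\<phi> t)" if "s \<in> {0..\<sigma>}" "t \<in> {0..\<sigma>}" for s t
    using incr[of s t] incr[of t s] that \<kappa> by (cases "s \<le> t") (auto simp: dist_real_def field_simps)
  have \<phi>0: "\<phi> 0 = 0" using inj2[of "\<phi> 0" 0] \<phi>[of 0] \<sigma> d start by auto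
  have image: "\<phi> ` {0..\<sigma>} = {0..\<phi> \<sigma>}"
  proof
    show "\<phi> ` {0..\<sigma>} \<subseteq> {0..\<phi> \<sigma>}" using incr[of _ \<sigma>] \<phi>(1) \<sigma> by fastforce
    show "{0..\<phi> \<sigma>} \<subseteq> \<phi> ` {0..\<sigma>}"
    proof
      fix y assume "y \<in> {0..\<phi> \<sigma>}"
      then show "y \<in> \<phi> ` {0..\<sigma>}"
        using IVT'[of \<phi> 0 y \<sigma>] cont \<sigma> \<phi>0 by (auto simp: less_imp_le)
    qed
  qed
  have "inj_on \<phi> {0..\<sigma>}"
    using inv_le by (intro inj_onI) (metis dist_eq_0_iff dist_le_zero_iff mult_zero_right)
  then obtain \<eta> where \<eta>: "homeomorphism {0..\<sigma>} {0..\<phi> \<sigma>} \<phi> \<eta>"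
    using homeomorphism_compact[OF compact_Icc cont image] by blast
  have "(K / \<kappa>)-lipschitz_on {0..\<phi> \<sigma>} \<eta>"
  proof (rule lipschitz_onI)
    fix y z assume yz: "y \<in> {0..\<phi> \<sigma>}" "z \<in> {0..\<phi> \<sigma>}"
    have "\<eta> y \<in> {0..\<sigma>}" "\<eta> z \<in> {0..\<sigma>}" using \<eta> yz unfolding homeomorphism_def by blast+
    then show "dist (\<eta> y) (\<eta> z) \<le> K / \<kappa> * dist y z"
      using inv_le[of "\<eta> y" "\<eta> z"] homeomorphism_apply2[OF \<eta>] yz by simp
  qed (use K \<kappa> in simp)
  then have bilip: "bilipschitz_homeomorphism {0..\<sigma>} {0..\<phi> \<sigma>} \<phi>"
    unfolding bilipschitz_homeomorphism_def using \<eta> lip by blast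
  have "\<phi>' = \<phi>" if \<phi>': "\<phi>' \<in> extensional {0..\<sigma>}" "{0..\<phi>' \<sigma>} \<subseteq> {0..T}"
      "bilipschitz_homeomorphism {0..\<sigma>} {0..\<phi>' \<sigma>} \<phi>'" "\<forall>s\<in>{0..\<sigma>}. X\<^sub>1 s = X\<^sub>2 (\<phi>' s)" for \<phi>'
  proof -
    obtain \<eta>' where "homeomorphism {0..\<sigma>} {0..\<phi>' \<sigma>} \<phi>' \<eta>'"
      using \<phi>'(3) unfolding bilipschitz_homeomorphism_def by blast
    then have im': "\<phi>' ` {0..\<sigma>} = {0..\<phi>' \<sigma>}" and cont': "continuous_on {0..\<sigma>} \<phi>'"
      by (auto simp: homeomorphism_def)
    have "\<phi>' \<sigma> \<in> {0..\<phi>' \<sigma>}" unfolding im'[symmetric] using \<sigma> by auto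
    then have zero: "0 \<in> \<phi>' ` {0..\<sigma>}" unfolding im' by simp
    have "connected (\<phi>' ` {0..\<sigma>})" using cont' by (intro connected_continuous_image) auto
    \<comment> \<open>Beyond \<open>d\<close> no information on \<open>X\<^sub>2\<close> is
      available. A competitor going there would take the value \<open>d\<close>, as its image is an
      interval starting at 0, and \<open>below\<close> excludes that.\<close>
    have le_d: "\<phi>' s \<le> d" if s: "s \<in> {0..\<sigma>}" for s
    proof (rule ccontr)
      assume "\<not> \<phi>' s \<le> d"
      then have "d \<in> {0..\<phi>' s}" using d by auto
      moreover have "\<phi>' s \<in> \<phi>' ` {0..\<sigma>}" using s by blast
      ultimately have "d \<in> \<phi>' ` {0..\<sigma>}" unfolding im' by auto
      then obtain s' where "s' \<in> {0..\<sigma>}" "\<phi>' s' = d" by auto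
      then show False using \<phi>'(4) below[of s'] by auto
    qed
    have "\<phi>' s = \<phi> s" if s: "s \<in> {0..\<sigma>}" for s
    proof (rule inj2)
      have "\<phi>' s \<in> \<phi>' ` {0..\<sigma>}" using s by blast
      then show "\<phi>' s \<in> {0..d}" using le_d[OF s] unfolding im' by auto
      show "g (X\<^sub>2 (\<phi>' s)) = g (X\<^sub>2 (\<phi> s))" using \<phi>'(4) \<phi>(2)[OF s] s by simp
    qed (rule \<phi>(1)[OF s])
    then show ?thesis
      using \<phi>'(1) by (intro extensionalityI[of _ "{0..\<sigma>}"]) (auto simp: \<phi>_def)
  qed
  moreover have "\<phi> \<in> extensional {0..\<sigma>} \<and> {0..\<phi> \<sigma>} \<subseteq> {0..T} \<and>
           bilipschitz_homeomorphism {0..\<sigma>} {0..\<phi> \<sigma>} \<phi> \<and> (\<forall>s\<in>{0..\<sigma>}. X\<^sub>1 s = X\<^sub>2 (\<phi> s))"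
  proof (intro conjI ballI)
    show "\<phi> \<in> extensional {0..\<sigma>}" by (simp add: \<phi>_def)
    show "{0..\<phi> \<sigma>} \<subseteq> {0..T}" using \<phi>(1)[of \<sigma>] \<sigma> d by auto
    show "X\<^sub>1 s = X\<^sub>2 (\<phi> s)" if "s \<in> {0..\<sigma>}" for s
      using that \<phi>[OF that] \<sigma> d by (intro cross) auto
  qed (rule bilip)
  ultimately have ex1: "\<exists>!\<phi>. \<phi> \<in> extensional {0..\<sigma>} \<and> {0..\<phi> \<sigma>} \<subseteq> {0..T} \<and>
           bilipschitz_homeomorphism {0..\<sigma>} {0..\<phi> \<sigma>} \<phi> \<and> (\<forall>s\<in>{0..\<sigma>}. X\<^sub>1 s = X\<^sub>2 (\<phi> s))"
    by (intro ex1I[of _ \<phi>]) auto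
  have "\<sigma> \<in> {0<..T}" using \<sigma> d by auto
  show ?thesis by (intro bexI[where x = \<sigma>]) fact+
qed

section \<open>Gradient of the Hamiltonian, and increments of the arcs\<close>

lemma C1_on_imp_continuous_on:
  assumes "C1_on S f"
  shows "continuous_on S f"
  using assms unfolding C1_on_def
  by (meson continuous_at_imp_continuous_on has_derivative_continuous)

text \<open>Justifies the description operator in \<open>H_p\<close>: the joint derivative
  restricted to the second factor is represented by the vector \<open>G\<close>, and derivatives are
  unique.\<close>

lemma GDERIV_H_p:
  fixes H :: "'a::real_normed_vector \<Rightarrow> 'b::euclidean_space \<Rightarrow> real"
  assumes "C1_on (S \<times> UNIV) (\<lambda>(x, p). H x p)" and "x \<in> S"
  shows "GDERIV (H x) p :> H_p H x p"
proof -
  obtain f' where f': "((\<lambda>(x, p). H x p) has_derivative blinfun_apply f') (at (x, p))"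
    using assms unfolding C1_on_def by auto
  have "((\<lambda>q. (x, q)) has_derivative (\<lambda>h. (0, h))) (at p)"
    by (auto intro!: derivative_eq_intros)
  from diff_chain_at[OF this f'] have der: "(H x has_derivative (\<lambda>h. f' (0, h))) (at p)"
    by (simp add: o_def)
  define G where "G = (\<Sum>i\<in>Basis. f' (0, i) *\<^sub>R i)"
  have lin: "linear (\<lambda>h. f' (0, h))" using has_derivative_linear[OF der] .
  have "f' (0, h) = h \<bullet> G" for h
  proof -
    have "f' (0, h) = f' (0, \<Sum>i\<in>Basis. (h \<bullet> i) *\<^sub>R i)" by (simp add: euclidean_representation)
    also have "\<dots> = (\<Sum>i\<in>Basis. f' (0, (h \<bullet> i) *\<^sub>R i))" by (rule linear_sum[OF lin])
    also have "\<dots> = (\<Sum>i\<in>Basis. (h \<bullet> i) * f' (0, i))"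
      by (intro sum.cong refl) (use linear_cmul[OF lin] in simp)
    finally show ?thesis by (simp add: G_def inner_sum_right mult.commute)
  qed
  then have G: "GDERIV (H x) p :> G" using der by (simp add: gderiv_def)
  have "G' = G" if "GDERIV (H x) p :> G'" for G'
  proof -
    have "(\<lambda>h. h \<bullet> G') = (\<lambda>h. h \<bullet> G)"
      using that G unfolding gderiv_def by (rule has_derivative_unique)
    then have "h \<bullet> (G' - G) = 0" for h by (simp add: inner_diff_right fun_eq_iff)
    from this[of "G' - G"] show ?thesis by simp
  qed
  with G show ?thesis unfolding H_p_def by (metis theI)
qed

text \<open>Otherwise \<open>f\<close> would decrease at first on the segment from \<open>p\<close>
  to \<open>q\<close>. Applied to the minimiser of \<open>H\<close>, it places that point in the
  face exposed by the initial velocity.\<close>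

lemma gradient_inner_nonneg_at_minimum:
  fixes f :: "'a::real_inner \<Rightarrow> real"
  assumes "convex S" "p \<in> S" "q \<in> S" and min: "\<And>r. r \<in> S \<Longrightarrow> f p \<le> f r" and G: "GDERIV f p :> G"
  shows "p \<bullet> G \<le> q \<bullet> G"
proof (rule ccontr)
  assume neg: "\<not> ?thesis"
  have path: "((\<lambda>t. p + t *\<^sub>R (q - p)) has_derivative (\<lambda>h. h *\<^sub>R (q - p))) (at 0)"
    by (auto intro!: derivative_eq_intros)
  have "(f has_derivative (\<lambda>h. h \<bullet> G)) (at (p + 0 *\<^sub>R (q - p)))" using G by (simp add: gderiv_def)
  from diff_chain_at[OF path this]
  have "((\<lambda>t. f (p + t *\<^sub>R (q - p))) has_derivative (\<lambda>h. (h *\<^sub>R (q - p)) \<bullet> G)) (at 0)"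
    by (simp only: o_def)
  then have "((\<lambda>t. f (p + t *\<^sub>R (q - p))) has_real_derivative ((q - p) \<bullet> G)) (at 0)"
    unfolding has_field_derivative_def by (rule has_derivative_eq_rhs) (simp add: fun_eq_iff)
  moreover have "(q - p) \<bullet> G < 0" using neg by (simp add: inner_diff_left)
  ultimately obtain e where e: "e > 0" "\<And>h. h > 0 \<Longrightarrow> h < e \<Longrightarrow> f (p + h *\<^sub>R (q - p)) < f p"
    using DERIV_neg_dec_right[of "\<lambda>t. f (p + t *\<^sub>R (q - p))" "(q - p) \<bullet> G" 0] by auto
  define h where "h = min 1 (e / 2)"
  have h: "0 < h" "h < e" "h \<le> 1" using e by (auto simp: h_def)
  have "(1 - h) *\<^sub>R p + h *\<^sub>R q \<in> S" using h assms(1-3) by (intro convexD) auto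
  moreover have "(1 - h) *\<^sub>R p + h *\<^sub>R q = p + h *\<^sub>R (q - p)" by (simp add: algebra_simps)
  ultimately show False using min e(2)[of h] h by fastforce
qed

text \<open>With tolerance \<open>norm v / 2\<close> the component along \<open>v\<close> grows at a
  speed between one half and three halves of \<open>v \<bullet> v\<close>.\<close>

lemma arc_increment_along:
  fixes X :: "real \<Rightarrow> 'a::euclidean_space"
  assumes X: "X \<in> Lip0 T \<Omega>" and "T > 0" and vd: "(X has_vector_derivative v) (at_right 0)" and "v \<noteq> 0"
  obtains d where "0 < d" "d \<le> T"
    "\<And>s t. 0 \<le> s \<Longrightarrow> s \<le> t \<Longrightarrow> t \<le> d \<Longrightarrow> norm (X t - X s - (t - s) *\<^sub>R v) \<le> norm v / 2 * (t - s)"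
proof -
  have "norm v / 2 > 0" using \<open>v \<noteq> 0\<close> by simp
  from Lip0_derivative_near[OF X \<open>T > 0\<close> vd this] obtain d N where d: "0 < d" "d \<le> T" "negligible N"
    and der: "\<And>t. 0 < t \<Longrightarrow> t < d \<Longrightarrow> t \<notin> N \<Longrightarrow> \<exists>w. (X has_vector_derivative w) (at t) \<and> norm (w - v) \<le> norm v / 2"
    by blast
  obtain L where L: "L-lipschitz_on {0..T} X" using X by (auto simp: Lip0_def)
  show ?thesis
  proof (rule that[OF d(1,2)])
    fix s t :: real assume st: "0 \<le> s" "s \<le> t" "t \<le> d"
    have "L-lipschitz_on {s..t} X" using L by (rule lipschitz_on_subset) (use st d in auto)
    then show "norm (X t - X s - (t - s) *\<^sub>R v) \<le> norm v / 2 * (t - s)"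
      by (rule norm_increment_diff_le[OF _ st(2) d(3)]) (use der st in auto)
  qed
qed

lemma inner_increment_bounds:
  fixes z v :: "'a::real_inner"
  assumes "norm (z - a *\<^sub>R v) \<le> norm v / 2 * a"
  shows "v \<bullet> v / 2 * a \<le> z \<bullet> v" "z \<bullet> v \<le> 3 / 2 * (v \<bullet> v) * a" "norm z \<le> 3 / 2 * norm v * a"
proof -
  have "\<bar>(z - a *\<^sub>R v) \<bullet> v\<bar> \<le> norm (z - a *\<^sub>R v) * norm v" by (rule Cauchy_Schwarz_ineq2)
  also have "\<dots> \<le> norm v / 2 * a * norm v" using assms by (rule mult_right_mono) simp
  also have "\<dots> = v \<bullet> v / 2 * a" by (simp add: dot_square_norm power2_eq_square)
  finally have "\<bar>z \<bullet> v - a * (v \<bullet> v)\<bar> \<le> v \<bullet> v / 2 * a" by (simp add: inner_diff_left)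
  moreover have eqs: "v \<bullet> v / 2 * a = a * (v \<bullet> v) / 2" "3 / 2 * (v \<bullet> v) * a = 3 * (a * (v \<bullet> v)) / 2"
    by simp_all
  ultimately show "v \<bullet> v / 2 * a \<le> z \<bullet> v" "z \<bullet> v \<le> 3 / 2 * (v \<bullet> v) * a"
    using eqs by linarith+
  \<comment> \<open>The sign of \<open>a\<close> is read off from the norm bound; for
    \<open>v = 0\<close> the equation for the norm of \<open>a *\<^sub>R v\<close> is
    trivial.\<close>
  have "norm v * a \<ge> 0" using assms order_trans[OF norm_ge_zero assms] by simp
  then have "a * norm v \<ge> 0" by (simp add: mult.commute)
  then have na: "norm (a *\<^sub>R v) = a * norm v" by (cases "norm v = 0") (auto simp: zero_le_mult_iff)
  have "norm z \<le> norm (z - a *\<^sub>R v) + norm (a *\<^sub>R v)"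
    by (metis diff_add_cancel norm_triangle_ineq)
  then show "norm z \<le> 3 / 2 * norm v * a" using assms na
    by (simp only: mult.commute[of a "norm v"] mult.assoc)
qed

section \<open>Comparison of the two arcs\<close>

context hamilton_jacobi_solution
begin

theorem singular_arcs_reparametrisation:
  assumes x0: "x0 \<in> \<Omega>" and p0: "p0 \<in> D x0" and v: "v \<noteq> 0" and min: "\<And>q. q \<in> D x0 \<Longrightarrow> p0 \<bullet> v \<le> q \<bullet> v"
    and neg: "H x0 p0 < 0" and T: "T > 0"
    and X: "X\<^sub>1 \<in> Lip0_sing u T \<Omega>" "X\<^sub>2 \<in> Lip0_sing u T \<Omega>" and start: "X\<^sub>1 0 = x0" "X\<^sub>2 0 = x0"
    and vd: "(X\<^sub>1 has_vector_derivative v) (at_right 0)" "(X\<^sub>2 has_vector_derivative v) (at_right 0)"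
  shows "\<exists>\<sigma>\<in>{0<..T}. \<exists>!\<phi>. \<phi> \<in> extensional {0..\<sigma>} \<and> {0..\<phi> \<sigma>} \<subseteq> {0..T} \<and>
           bilipschitz_homeomorphism {0..\<sigma>} {0..\<phi> \<sigma>} \<phi> \<and> (\<forall>s\<in>{0..\<sigma>}. X\<^sub>1 s = X\<^sub>2 (\<phi> s))"
proof -
  have vv: "v \<bullet> v > 0" "norm v > 0" using v by auto
  have np: "norm (perp v) = norm v" by (simp add: norm_eq_sqrt_inner)
  have "continuous_on UNIV (\<lambda>p. H x0 p)"
  proof -
    have "continuous_on UNIV (\<lambda>p. (x0, p))" by (intro continuous_intros)
    from continuous_on_compose2[OF H_continuous this] show ?thesis using x0 by auto
  qed
  then have "isCont (H x0) p0" by (simp add: continuous_on_eq_continuous_at)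
  then have "\<forall>\<^sub>F p in at p0. H x0 p < 0" unfolding isCont_def using neg by (rule order_tendstoD(2))
  then obtain \<eta> where \<eta>: "\<eta> > 0" "\<And>p. dist p p0 < \<eta> \<Longrightarrow> H x0 p < 0"
    using neg unfolding eventually_at by (metis UNIV_I)
  \<comment> \<open>\<open>perp v\<close> has the length of \<open>v\<close>, so the shift by
    \<open>c\<close> has length \<open>\<eta> / 2\<close> and stays where \<open>H x0\<close> is
    negative.\<close>
  define c where "c = \<eta> / (2 * norm v)"
  have c: "c > 0" "c * norm v < \<eta>" using \<eta> vv by (auto simp: c_def)
  have negc: "H x0 (p0 + c *\<^sub>R (\<sigma> *\<^sub>R perp v)) < 0" if "\<sigma> = 1 \<or> \<sigma> = -1" for \<sigma>
    using that c np by (intro \<eta>(2)) (auto simp: dist_norm)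
  have arc: "\<exists>d. 0 < d \<and> d \<le> T \<and>
      (\<forall>t. 0 < t \<and> t < d \<longrightarrow> (\<exists>p\<in>D (Y t). c * (perp v \<bullet> perp v) \<le> (p - p0) \<bullet> perp v)) \<and>
      (\<forall>t. 0 < t \<and> t < d \<longrightarrow> (\<exists>p\<in>D (Y t). c * (perp v \<bullet> perp v) \<le> (p - p0) \<bullet> (- perp v))) \<and>
      (\<forall>s t. 0 \<le> s \<and> s \<le> t \<and> t \<le> d \<longrightarrow> norm (Y t - Y s - (t - s) *\<^sub>R v) \<le> norm v / 2 * (t - s))"
    if Y: "Y \<in> Lip0_sing u T \<Omega>" "Y 0 = x0" "(Y has_vector_derivative v) (at_right 0)" for Y
  proof -
    have YL: "Y \<in> Lip0 T \<Omega>" using Y by (simp add: Lip0_sing_def)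
    obtain d1 where d1: "0 < d1" "d1 \<le> T"
      "\<And>t. 0 < t \<Longrightarrow> t < d1 \<Longrightarrow> \<exists>p\<in>D (Y t). c * (v \<bullet> v) \<le> (p - p0) \<bullet> (1 *\<^sub>R perp v)"
      using arc_superdiff_beyond[OF x0 p0 v min disjI1[OF refl] negc[OF disjI1[OF refl]] T Y] by blast
    obtain d2 where d2: "0 < d2" "d2 \<le> T"
      "\<And>t. 0 < t \<Longrightarrow> t < d2 \<Longrightarrow> \<exists>p\<in>D (Y t). c * (v \<bullet> v) \<le> (p - p0) \<bullet> ((-1) *\<^sub>R perp v)"
      using arc_superdiff_beyond[OF x0 p0 v min disjI2[OF refl] negc[OF disjI2[OF refl]] T Y] by blast
    obtain d3 where d3: "0 < d3" "d3 \<le> T"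
      "\<And>s t. 0 \<le> s \<Longrightarrow> s \<le> t \<Longrightarrow> t \<le> d3 \<Longrightarrow> norm (Y t - Y s - (t - s) *\<^sub>R v) \<le> norm v / 2 * (t - s)"
      using arc_increment_along[OF YL T Y(3) v] by blast
    show ?thesis
      by (intro exI[of _ "min d1 (min d2 d3)"]) (use d1 d2 d3 in simp)
  qed
  obtain d1 where d1: "0 < d1" "d1 \<le> T"
      "\<And>t. 0 < t \<and> t < d1 \<longrightarrow> (\<exists>p\<in>D (X\<^sub>1 t). c * (perp v \<bullet> perp v) \<le> (p - p0) \<bullet> perp v)"
      "\<And>t. 0 < t \<and> t < d1 \<longrightarrow> (\<exists>p\<in>D (X\<^sub>1 t). c * (perp v \<bullet> perp v) \<le> (p - p0) \<bullet> (- perp v))"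
      "\<And>s t. 0 \<le> s \<and> s \<le> t \<and> t \<le> d1 \<longrightarrow> norm (X\<^sub>1 t - X\<^sub>1 s - (t - s) *\<^sub>R v) \<le> norm v / 2 * (t - s)"
    using arc[OF X(1) start(1) vd(1)] by blast
  obtain d2 where d2: "0 < d2" "d2 \<le> T"
      "\<And>t. 0 < t \<and> t < d2 \<longrightarrow> (\<exists>p\<in>D (X\<^sub>2 t). c * (perp v \<bullet> perp v) \<le> (p - p0) \<bullet> perp v)"
      "\<And>t. 0 < t \<and> t < d2 \<longrightarrow> (\<exists>p\<in>D (X\<^sub>2 t). c * (perp v \<bullet> perp v) \<le> (p - p0) \<bullet> (- perp v))"
      "\<And>s t. 0 \<le> s \<and> s \<le> t \<and> t \<le> d2 \<longrightarrow> norm (X\<^sub>2 t - X\<^sub>2 s - (t - s) *\<^sub>R v) \<le> norm v / 2 * (t - s)"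
    using arc[OF X(2) start(2) vd(2)] by blast
  obtain r where r: "r > 0" "ball x0 (3 * r) \<subseteq> \<Omega>" using superdiff_bounded_near[OF x0] by metis
  \<comment> \<open>Two points of \<open>ball x0 \<rho>\<close> differing by
    \<open>h *\<^sub>R perp v\<close> with \<open>h > 0\<close> satisfy
    \<open>h * norm v < 2 * \<rho>\<close>, hence \<open>C * h < 2 * c\<close>, against
    \<open>no_transversal_gap\<close>.\<close>
  define \<rho> where "\<rho> = min r (c * norm v / C)"
  have \<rho>: "\<rho> > 0" "\<rho> \<le> r" "C * \<rho> \<le> c * norm v"
    using r c vv C_pos by (auto simp: \<rho>_def min_def field_simps)
  \<comment> \<open>Halving keeps \<open>{0..d}\<close> strictly below \<open>d1\<close> and
    \<open>d2\<close>; the other bound limits the displacement \<open>3 / 2 * norm v * d\<close> to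
    three quarters of \<rho>.\<close>
  define d where "d = min (min d1 d2 / 2) (\<rho> / (2 * norm v))"
  have "0 < \<rho> / (2 * norm v)" using \<rho>(1) vv by simp
  then have d: "0 < d" "d < d1" "d < d2" "d \<le> T"
    using d1(1,2) d2(1) by (auto simp: d_def)
  have "d * norm v \<le> \<rho> / (2 * norm v) * norm v" by (intro mult_right_mono) (auto simp: d_def)
  then have dv: "norm v * d \<le> \<rho> / 2" using vv by (simp add: mult.commute)
  note inc1 = inner_increment_bounds[OF d1(5)[rule_format, OF conjI[OF _ conjI]]]
  note inc2 = inner_increment_bounds[OF d2(5)[rule_format, OF conjI[OF _ conjI]]]
  have near: "norm z < \<rho>" if "norm z \<le> 3 / 2 * norm v * t" "t \<le> d" for z :: "real^2" and t
  proof -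
    have "norm v * t \<le> norm v * d" using that by (intro mult_left_mono) auto
    then have "3 / 2 * norm v * t \<le> 3 / 4 * \<rho>" using dv unfolding mult.assoc by linarith
    then show ?thesis using that(1) \<rho>(1) by linarith
  qed
  have near1: "X\<^sub>1 t \<in> ball x0 \<rho>" if "t \<in> {0..d}" for t
    using near[of "X\<^sub>1 t - X\<^sub>1 0" t] inc1(3)[of 0 t] that d start by (simp add: dist_norm norm_minus_commute)
  have near2: "X\<^sub>2 t \<in> ball x0 \<rho>" if "t \<in> {0..d}" for t
    using near[of "X\<^sub>2 t - X\<^sub>2 0" t] inc2(3)[of 0 t] that d start by (simp add: dist_norm norm_minus_commute)
  have no_gap: "False"
    if xy: "x \<in> ball x0 \<rho>" "y \<in> ball x0 \<rho>" "x - y = h *\<^sub>R perp v" "h > 0"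
      and p: "\<exists>p\<in>D x. c * (perp v \<bullet> perp v) \<le> (p - p0) \<bullet> perp v"
      and q: "\<exists>q\<in>D y. c * (perp v \<bullet> perp v) \<le> (q - p0) \<bullet> (- perp v)" for x y h
  proof -
    have "x \<in> ball x0 r" "y \<in> ball x0 r" using xy \<rho>(2) by auto
    moreover have "perp v \<noteq> 0" using np vv by auto
    ultimately have "2 * c \<le> C * h"
      using p q no_transversal_gap[OF r(2) _ _ _ _ _ _ _ xy(3,4)] by blast
    have "h * norm v = dist x y" using xy(3,4) np by (simp add: dist_norm)
    also have "\<dots> < 2 * \<rho>" using xy(1,2) dist_triangle[of x y x0] by (simp add: dist_commute)
    finally have "C * (h * norm v) < C * (2 * \<rho>)" using C_pos by simp
    also have "\<dots> \<le> 2 * c * norm v" using \<rho>(3) by simp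
    finally have "C * h < 2 * c" using vv by (simp add: mult.assoc[symmetric])
    with \<open>2 * c \<le> C * h\<close> show False by simp
  qed
  show ?thesis
  proof (rule unique_bilipschitz_reparametrisation[where g = "\<lambda>z. z \<bullet> v" and \<kappa> = "v \<bullet> v / 2" and K = "3 / 2 * (v \<bullet> v)"])
    show "0 < d" "d \<le> T" "0 < v \<bullet> v / 2" using d vv by auto
    show "X\<^sub>1 0 \<bullet> v = X\<^sub>2 0 \<bullet> v" using start by simp
  next
    fix s t :: real assume st: "0 \<le> s" "s \<le> t" "t \<le> d"
    show "v \<bullet> v / 2 * (t - s) \<le> X\<^sub>1 t \<bullet> v - X\<^sub>1 s \<bullet> v" "X\<^sub>1 t \<bullet> v - X\<^sub>1 s \<bullet> v \<le> 3 / 2 * (v \<bullet> v) * (t - s)"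
      using inc1(1,2)[of s t] st d by (auto simp: inner_diff_left)
    show "v \<bullet> v / 2 * (t - s) \<le> X\<^sub>2 t \<bullet> v - X\<^sub>2 s \<bullet> v" "X\<^sub>2 t \<bullet> v - X\<^sub>2 s \<bullet> v \<le> 3 / 2 * (v \<bullet> v) * (t - s)"
      using inc2(1,2)[of s t] st d by (auto simp: inner_diff_left)
  next
    fix s t assume st: "s \<in> {0..d}" "t \<in> {0..d}" and eq: "X\<^sub>1 s \<bullet> v = X\<^sub>2 t \<bullet> v"
    have low: "v \<bullet> v / 2 * s \<le> X\<^sub>1 s \<bullet> v - x0 \<bullet> v" "v \<bullet> v / 2 * t \<le> X\<^sub>2 t \<bullet> v - x0 \<bullet> v"
       "X\<^sub>1 s \<bullet> v - x0 \<bullet> v \<le> 3 / 2 * (v \<bullet> v) * s" "X\<^sub>2 t \<bullet> v - x0 \<bullet> v \<le> 3 / 2 * (v \<bullet> v) * t"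
      using inc1(1,2)[of 0 s] inc2(1,2)[of 0 t] st d start by (auto simp: inner_diff_left)
    show "X\<^sub>1 s = X\<^sub>2 t"
    \<comment> \<open>The supergradients beyond \<open>p0\<close> are provided for positive times,
      so time 0 is settled by heights: at positive times both arcs are strictly above
      \<open>x0\<close>.\<close>
    proof (cases "s = 0 \<or> t = 0")
      case True
      have "s = 0 \<and> t = 0"
      proof (rule ccontr)
        assume "\<not> ?thesis"
        then have "s > 0 \<and> t = 0 \<or> s = 0 \<and> t > 0" using True st by auto
        then have "v \<bullet> v / 2 * s > 0 \<and> t = 0 \<or> s = 0 \<and> v \<bullet> v / 2 * t > 0" using vv(1) by auto
        then show False using low eq by auto
      qed
      then show ?thesis using start by simp
    next
      case False
      then have pos: "0 < s \<and> s < d1" "0 < t \<and> t < d2" using st d by auto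
      have "(X\<^sub>1 s - X\<^sub>2 t) \<bullet> v = 0" using eq by (simp add: inner_diff_left)
      then obtain h where h: "X\<^sub>1 s - X\<^sub>2 t = h *\<^sub>R perp v" using v by (rule orthogonal_imp_multiple_perp)
      have "\<not> h > 0"
        using no_gap[OF near1[OF st(1)] near2[OF st(2)] h _ d1(3)[rule_format, OF pos(1)] d2(4)[rule_format, OF pos(2)]] by blast
      \<comment> \<open>For the other sign the arcs exchange roles, which is why each arc was given
        supergradients on both sides of \<open>p0\<close>.\<close>
      moreover have h': "X\<^sub>2 t - X\<^sub>1 s = (- h) *\<^sub>R perp v" using h by (simp add: algebra_simps)
      have "\<not> - h > 0"
        using no_gap[OF near2[OF st(2)] near1[OF st(1)] h' _ d2(3)[rule_format, OF pos(2)] d1(4)[rule_format, OF pos(1)]] by blast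
      ultimately have "h = 0" by simp
      then show ?thesis using h by simp
    qed
  qed
qed

end

theorem theorem3p6:
  fixes \<Omega> :: "(real^2) set"
    and H :: "real^2 \<Rightarrow> real^2 \<Rightarrow> real"
    and u :: "real^2 \<Rightarrow> real"
    and x\<^sub>0 p\<^sub>0 :: "real^2"
    and T :: real
    and X\<^sub>1 X\<^sub>2 :: "real \<Rightarrow> real^2"
  assumes "open \<Omega>" and "connected \<Omega>" and "bounded \<Omega>"
    and "C1_on (\<Omega> \<times> UNIV) (\<lambda>(x, p). H x p)"
    and "\<forall>x\<in>\<Omega>. strictly_convex (H x)"
    and "semiconcave \<Omega> u"
    and "viscosity_solution \<Omega> H u"
    and "x\<^sub>0 \<in> Sing \<Omega> u"
    and "0 \<notin> H_p H x\<^sub>0 ` superdiff \<Omega> u x\<^sub>0"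
    and "is_arg_min (H x\<^sub>0) (\<lambda>p. p \<in> superdiff \<Omega> u x\<^sub>0) p\<^sub>0"
    and "T > 0"
    and "X\<^sub>1 \<in> Lip0_sing u T \<Omega>" and "X\<^sub>2 \<in> Lip0_sing u T \<Omega>"
    and "X\<^sub>1 0 = x\<^sub>0" and "X\<^sub>2 0 = x\<^sub>0"
    and "(X\<^sub>1 has_vector_derivative H_p H x\<^sub>0 p\<^sub>0) (at_right 0)"
    and "(X\<^sub>2 has_vector_derivative H_p H x\<^sub>0 p\<^sub>0) (at_right 0)"
  shows "\<exists>\<sigma>\<in>{0<..T}. \<exists>!\<phi>. \<phi> \<in> extensional {0..\<sigma>} \<and>
           {0..\<phi> \<sigma>} \<subseteq> {0..T} \<and>
           bilipschitz_homeomorphism {0..\<sigma>} {0..\<phi> \<sigma>} \<phi> \<and>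
           (\<forall>s\<in>{0..\<sigma>}. X\<^sub>1 s = X\<^sub>2 (\<phi> s))"
proof -
  obtain C where C: "C > 0" and sc: "\<And>x y l. x \<in> \<Omega> \<Longrightarrow> y \<in> \<Omega> \<Longrightarrow> closed_segment x y \<subseteq> \<Omega> \<Longrightarrow> 0 \<le> l \<Longrightarrow> l \<le> 1 \<Longrightarrow>
      l * u x + (1 - l) * u y - u (l *\<^sub>R x + (1 - l) *\<^sub>R y) \<le> C / 2 * l * (1 - l) * (norm (x - y))\<^sup>2"
    using \<open>semiconcave \<Omega> u\<close> unfolding semiconcave_def by (metis atLeastAtMost_iff)
  interpret hamilton_jacobi_solution \<Omega> u C H
    using assms(1,5,7) C sc C1_on_imp_continuous_on[OF assms(4)]
    by unfold_locales
      (auto simp: viscosity_solution_def viscosity_subsolution_def viscosity_supersolution_def)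
  have x0: "x\<^sub>0 \<in> \<Omega>" using assms(8) by (simp add: Sing_def)
  have p0: "p\<^sub>0 \<in> D x\<^sub>0" and le: "\<And>q. q \<in> D x\<^sub>0 \<Longrightarrow> H x\<^sub>0 p\<^sub>0 \<le> H x\<^sub>0 q"
    using assms(10) by (auto simp: is_arg_min_linorder)
  have G: "GDERIV (H x\<^sub>0) p\<^sub>0 :> H_p H x\<^sub>0 p\<^sub>0" by (rule GDERIV_H_p[OF assms(4) x0])
  have conv: "convex (D x\<^sub>0)" by (rule convex_superdiff[OF x0])
  \<comment> \<open>Singularity supplies a second supergradient \<open>q\<close>. At the midpoint
    strict convexity gives less than the average of two nonpositive values, and the minimum is no
    larger.\<close>
  have "H x\<^sub>0 p\<^sub>0 < 0"
  proof -
    have "D x\<^sub>0 \<noteq> {p\<^sub>0}" using assms(8) by (auto simp: Sing_def is_singleton_def)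
    then obtain q where q: "q \<in> D x\<^sub>0" "q \<noteq> p\<^sub>0" using p0 by blast
    have "(1/2) *\<^sub>R p\<^sub>0 + (1 - 1/2) *\<^sub>R q \<in> D x\<^sub>0" using p0 q by (intro convexD[OF conv]) auto
    then have "H x\<^sub>0 p\<^sub>0 \<le> H x\<^sub>0 ((1/2) *\<^sub>R p\<^sub>0 + (1 - 1/2) *\<^sub>R q)" by (rule le)
    also have "\<dots> < 1/2 * H x\<^sub>0 p\<^sub>0 + (1 - 1/2) * H x\<^sub>0 q"
      using H_convex[OF x0, unfolded strictly_convex_def, rule_format, of "p\<^sub>0" q "1/2"] q(2) by simp
    also have "\<dots> \<le> 0" using subsolution[OF x0 p0] subsolution[OF x0 q(1)] by simp
    finally show ?thesis .
  qed
  moreover have "H_p H x\<^sub>0 p\<^sub>0 \<noteq> 0" using assms(9) p0 by force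
  moreover have "p\<^sub>0 \<bullet> H_p H x\<^sub>0 p\<^sub>0 \<le> q \<bullet> H_p H x\<^sub>0 p\<^sub>0" if "q \<in> D x\<^sub>0" for q
    by (rule gradient_inner_nonneg_at_minimum[OF conv p0 that le G])
  ultimately show ?thesis
    by (intro singular_arcs_reparametrisation[OF x0 p0 _ _ _ assms(11-17)])
qed

end
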